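(* Let $X\subset\mathbb{P}^n(\mathbb{C})$ be a compact connected real analytic submanifold that is invariant under $A=\exp(\mathfrak{a})$, where $\mathfrak{a}\subset i\,\mathfrak{su}(n+1)$ is an abelian subalgebra. Let $\mu_{\mathfrak a}:\mathbb{P}^n(\mathbb{C})\to\mathfrak{a}$ be the gradient map associated with $A$ (defined in the context), and let $X^A$ be the set of points of $X$ fixed by $A$. Then: (a) $\mu_{\mathfrak a}(X)$ is a convex polytope with vertices in $\mu_{\mathfrak a}(X^A)$; (b) the set $\{x\in X:\ \mu_{\mathfrak a}(\overline{A\cdot x})=\mu_{\mathfrak a}(X)\}$ is open and dense in $X$; (c) for any face $\sigma\subset\mu_{\mathfrak a}(X)$ there is an $A$-orbit $Y\subset X$ such that $\mu_{\mathfrak a}(\overline{Y})=\sigma$.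
   Context: The group $SL(n+1,\mathbb{C})=SU(n+1)^{\mathbb{C}}$ acts on $\mathbb{P}^n(\mathbb{C})$ in the standard way, and $\mathbb{P}^n(\mathbb{C})$ carries the Fubini-Study Kähler form $\omega$. Let $\mu:\mathbb{P}^n(\mathbb{C})\to\mathfrak{su}(n+1)^*$ be the momentum map of the $SU(n+1)$-action: it is equivariant and $d\mu^\beta=i_{\beta_Z}\omega$ for all $\beta\in\mathfrak{su}(n+1)$, where $\mu^\beta=\langle\mu,\beta\rangle$ and $\beta_Z$ is the fundamental vector field on $Z=\mathbb{P}^n(\mathbb{C})$. Fix an $SU(n+1)$-invariant scalar product $\langle\,,\,\rangle$ on $\mathfrak{su}(n+1)$, use it to identify $\mathfrak{su}(n+1)^*\cong\mathfrak{su}(n+1)$, and also denote by $\langle\,,\,\rangle$ the scalar product on $i\,\mathfrak{su}(n+1)$ (traceless Hermitian matrices) such that multiplication by $i$ is an isometry. The gradient map $\mu_{\mathfrak a}:\mathbb{P}^n(\mathbb{C})\to\mathfrak{a}$ is defined by $\langle\mu_{\mathfrak a}(z),\beta\rangle=-\langle\mu(z),i\beta\rangle$ for all $\beta\in\mathfrak{a}$. Explicitly, $\langle\mu_{\mathfrak a}([v]),\beta\rangle=c\,\dfrac{\langle\beta v,v\rangle}{|v|^2}$ for $v\in\mathbb{C}^{n+1}\setminus\{0\}$, with the standard Hermitian product on the right and a constant $c>0$ depending only on the normalization of the Fubini-Study form. Faces of a polytope are nonempty and include the polytope itself. *)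

theory Defs
  imports "HOL-Analysis.Analysis"
begin

section \<open>Complex projective space\<close>

text \<open>With \<open>CARD('n) = n + 1\<close>, the type \<open>'n cproj\<close> is the space of complex lines in
  \<open>\<complex>\<^sup>n\<^sup>+\<^sup>1\<close>, with the quotient topology from \<open>\<complex>\<^sup>n\<^sup>+\<^sup>1 - {0}\<close>.\<close>

typedef ('n::finite) cproj = "{range (\<lambda>c. c *s v) | v :: complex^'n. v \<noteq> 0}"
  morphisms line_of Abs_cproj
proof -
  have "(\<chi> i. 1) \<noteq> (0 :: complex^'n)"
    by (simp add: vec_eq_iff)
  then show ?thesis by blast
qed

text \<open>The point \<open>[v]\<close>; only meaningful for \<open>v \<noteq> 0\<close>.\<close>

definition proj :: "complex^'n \<Rightarrow> ('n::finite) cproj" where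
  "proj v = Abs_cproj (range (\<lambda>c. c *s v))"

instantiation cproj :: (finite) topological_space
begin

definition open_cproj :: "'a cproj set \<Rightarrow> bool" where
  "open_cproj U \<longleftrightarrow> open {v. v \<noteq> 0 \<and> proj v \<in> U}"

instance
proof
  have "{v :: complex^'a. v \<noteq> 0} = - {0}" by auto
  then show "open (UNIV :: 'a cproj set)"
    by (simp add: open_cproj_def open_Compl)
next
  fix S T :: "'a cproj set"
  assume "open S" "open T"
  then have "open ({v. v \<noteq> 0 \<and> proj v \<in> S} \<inter> {v. v \<noteq> 0 \<and> proj v \<in> T})"
    by (simp add: open_cproj_def open_Int)
  also have "{v. v \<noteq> 0 \<and> proj v \<in> S} \<inter> {v. v \<noteq> 0 \<and> proj v \<in> T} = {v. v \<noteq> 0 \<and> proj v \<in> S \<inter> T}"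
    by auto
  finally show "open (S \<inter> T)" by (simp add: open_cproj_def)
next
  fix K :: "'a cproj set set"
  assume "\<forall>S\<in>K. open S"
  then have "open (\<Union>S\<in>K. {v. v \<noteq> 0 \<and> proj v \<in> S})"
    by (auto simp: open_cproj_def)
  also have "(\<Union>S\<in>K. {v. v \<noteq> 0 \<and> proj v \<in> S}) = {v. v \<noteq> 0 \<and> proj v \<in> \<Union>K}"
    by auto
  finally show "open (\<Union>K)" by (simp add: open_cproj_def)
qed

end

text \<open>The action of \<open>GL(n+1,\<complex>)\<close>, \<open>g \<cdot> [v] = [g v]\<close>; only meaningful for invertible \<open>g\<close>.\<close>

definition pact :: "complex^'n^'n \<Rightarrow> ('n::finite) cproj \<Rightarrow> 'n cproj" where
  "pact g z = Abs_cproj ((\<lambda>v. g *v v) ` line_of z)"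

lemma line_of_proj: "v \<noteq> 0 \<Longrightarrow> line_of (proj v) = range (\<lambda>c. c *s v)"
  unfolding proj_def by (rule Abs_cproj_inverse) auto

lemma proj_cases: obtains v where "v \<noteq> 0" "z = proj v"
proof -
  from line_of[of z] obtain v where "v \<noteq> 0" "line_of z = range (\<lambda>c. c *s v)" by auto
  then show ?thesis using that by (metis line_of_inverse proj_def)
qed

lemma pact_proj:
  assumes "v \<noteq> 0"
  shows "pact g (proj v) = proj (g *v v)"
proof -
  have "(\<lambda>u. g *v u) ` range (\<lambda>c. c *s v) = range (\<lambda>c. c *s (g *v v))"
    by (simp add: image_image vector_scalar_commute)
  then show ?thesis
    unfolding pact_def line_of_proj[OF assms] by (simp add: proj_def)
qed


section \<open>Real analytic submanifolds\<close>

text \<open>A map is analytic if it is locally the sum of a power series in the coordinates, a multi-index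
  being a function \<open>\<alpha>\<close> supported on the basis. The set \<open>S\<close> is meant to be relatively open in an
  affine coordinate subspace \<open>H\<close>. For \<open>a, x \<in> H\<close> all monomials involving a coordinate that is
  constant on \<open>H\<close> vanish, so this is the usual power series expansion in the coordinates of \<open>H\<close>.\<close>

definition real_analytic_on ::
    "('a::euclidean_space \<Rightarrow> 'b::real_normed_vector) \<Rightarrow> 'a set \<Rightarrow> bool" where
  "real_analytic_on f S \<longleftrightarrow>
     (\<forall>a\<in>S. \<exists>(c :: ('a \<Rightarrow> nat) \<Rightarrow> 'b) r. r > 0 \<and>
        (\<forall>x\<in>S \<inter> ball a r.
           ((\<lambda>\<alpha>. (\<Prod>b\<in>Basis. ((x - a) \<bullet> b) ^ \<alpha> b) *\<^sub>R c \<alpha>) has_sum f x)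
             {\<alpha>. \<forall>b. b \<notin> Basis \<longrightarrow> \<alpha> b = 0}))"

text \<open>\<open>M\<close> is an embedded real analytic submanifold of the affine coordinate subspace \<open>H\<close>: around
  each of its points there is an analytic chart of \<open>H\<close>, with analytic inverse, that takes \<open>M\<close> to
  an affine subspace.\<close>

definition analytic_submanifold_in :: "'a::euclidean_space set \<Rightarrow> 'a set \<Rightarrow> bool" where
  "analytic_submanifold_in H M \<longleftrightarrow> M \<subseteq> H \<and>
     (\<forall>x\<in>M. \<exists>U V \<phi> \<psi> L.
        openin (top_of_set H) U \<and> x \<in> U \<and> openin (top_of_set H) V \<and>
        homeomorphism U V \<phi> \<psi> \<and> real_analytic_on \<phi> U \<and> real_analytic_on \<psi> V \<and>
        affine L \<and> \<phi> ` (M \<inter> U) = V \<inter> L)"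

text \<open>The standard affine charts \<open>[v] \<mapsto> v / v\<^sub>i\<close> identify \<open>{[v]. v\<^sub>i \<noteq> 0}\<close> with the
  hyperplane \<open>w\<^sub>i = 1\<close>, a copy of \<open>\<complex>\<^sup>n\<close>; the second set below is the image of \<open>X\<close>.\<close>

definition analytic_submanifold_cproj :: "('n::finite) cproj set \<Rightarrow> bool" where
  "analytic_submanifold_cproj X \<longleftrightarrow>
     (\<forall>i. analytic_submanifold_in {w :: complex^'n. w $ i = 1} {w. w $ i = 1 \<and> proj w \<in> X})"


section \<open>Matrices\<close>

definition cadj :: "complex^'n^'n \<Rightarrow> complex^'n^'n" where
  "cadj A = (\<chi> i j. cnj (A $ j $ i))"

definition imul :: "complex^'n^'n \<Rightarrow> complex^'n^'n" where
  "imul A = (\<chi> i j. \<i> * A $ i $ j)"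

definition SU :: "(complex^'n^'n) set" where
  "SU = {g. g ** cadj g = mat 1 \<and> cadj g ** g = mat 1 \<and> det g = 1}"

definition su :: "(complex^'n^'n) set" where
  "su = {\<xi>. cadj \<xi> = - \<xi> \<and> trace \<xi> = 0}"

definition mat_exp :: "complex^'n^'n \<Rightarrow> complex^'n^'n" where
  "mat_exp A = (\<Sum>k. (1 / fact k) *\<^sub>R (((**) A ^^ k) (mat 1)))"

text \<open>Subalgebras are real linear; being abelian makes closure under brackets automatic.\<close>

definition abelian_subalgebra_isu :: "(complex^'n^'n) set \<Rightarrow> bool" where
  "abelian_subalgebra_isu \<aa> \<longleftrightarrow>
     subspace \<aa> \<and> \<aa> \<subseteq> imul ` su \<and> (\<forall>\<xi>\<in>\<aa>. \<forall>\<eta>\<in>\<aa>. \<xi> ** \<eta> = \<eta> ** \<xi>)"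

definition invariant_scalar_product :: "(complex^'n^'n \<Rightarrow> complex^'n^'n \<Rightarrow> real) \<Rightarrow> bool" where
  "invariant_scalar_product ip \<longleftrightarrow>
     (\<forall>\<xi>\<in>su. \<forall>\<eta>\<in>su. \<forall>\<zeta>\<in>su. ip (\<xi> + \<eta>) \<zeta> = ip \<xi> \<zeta> + ip \<eta> \<zeta>) \<and>
     (\<forall>r. \<forall>\<xi>\<in>su. \<forall>\<eta>\<in>su. ip (r *\<^sub>R \<xi>) \<eta> = r * ip \<xi> \<eta>) \<and>
     (\<forall>\<xi>\<in>su. \<forall>\<eta>\<in>su. ip \<xi> \<eta> = ip \<eta> \<xi>) \<and>
     (\<forall>\<xi>\<in>su. \<xi> \<noteq> 0 \<longrightarrow> ip \<xi> \<xi> > 0) \<and>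
     (\<forall>g\<in>SU. \<forall>\<xi>\<in>su. \<forall>\<eta>\<in>su. ip (g ** \<xi> ** cadj g) (g ** \<eta> ** cadj g) = ip \<xi> \<eta>)"


section \<open>Momentum map and gradient map\<close>

definition herm :: "complex^'n \<Rightarrow> complex^'n \<Rightarrow> complex" where
  "herm x y = (\<Sum>i\<in>UNIV. x $ i * cnj (y $ i))"

text \<open>The pullback to \<open>\<complex>\<^sup>n\<^sup>+\<^sup>1 - {0}\<close> of the Fubini-Study form, at \<open>v\<close>, evaluated on \<open>u\<close> and
  \<open>w\<close>; this is \<open>\<kappa> \<i>/2\<close> times the
  \<open>\<partial>\<close>-\<open>\<partial>\<close>-bar derivative of \<open>log |v|\<^sup>2\<close>, where \<open>\<kappa> > 0\<close> is the normalization.\<close>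

definition fubini_study ::
    "real \<Rightarrow> complex^'n \<Rightarrow> complex^'n \<Rightarrow> complex^'n \<Rightarrow> real" where
  "fubini_study \<kappa> v u w =
     - \<kappa> * Im (herm u w / (norm v)\<^sup>2 - herm u v * herm v w / (norm v) ^ 4)"

text \<open>The momentum map takes values in \<open>su\<close>, identified with its dual by \<open>ip\<close>. The equation
  \<open>d\<mu>\<^sup>\<beta> = \<iota>(\<beta>\<^sub>Z) \<omega>\<close> is expressed after pulling back along the surjective submersion
  \<open>v \<mapsto> [v]\<close>, under which the fundamental field \<open>\<beta>\<^sub>Z\<close> lifts to \<open>v \<mapsto> \<beta> v\<close>.\<close>

definition momentum_map ::
    "real \<Rightarrow> (complex^'n^'n \<Rightarrow> complex^'n^'n \<Rightarrow> real) \<Rightarrow> (('n::finite) cproj \<Rightarrow> complex^'n^'n) \<Rightarrow> bool" where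
  "momentum_map \<kappa> ip \<mu> \<longleftrightarrow>
     (\<forall>z. \<mu> z \<in> su) \<and>
     (\<forall>g\<in>SU. \<forall>z. \<mu> (pact g z) = g ** \<mu> z ** cadj g) \<and>
     (\<forall>\<beta>\<in>su. \<forall>v. v \<noteq> 0 \<longrightarrow>
        ((\<lambda>v. ip (\<mu> (proj v)) \<beta>) has_derivative (\<lambda>w. fubini_study \<kappa> v (\<beta> *v v) w)) (at v))"

text \<open>The scalar product on \<open>\<i> su\<close> making multiplication by \<open>\<i>\<close> an isometry.\<close>

definition ip_isu ::
    "(complex^'n^'n \<Rightarrow> complex^'n^'n \<Rightarrow> real) \<Rightarrow> complex^'n^'n \<Rightarrow> complex^'n^'n \<Rightarrow> real" where
  "ip_isu ip \<beta> \<gamma> = ip (imul \<beta>) (imul \<gamma>)"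

definition gradient_map ::
    "(complex^'n^'n \<Rightarrow> complex^'n^'n \<Rightarrow> real) \<Rightarrow> (('n::finite) cproj \<Rightarrow> complex^'n^'n) \<Rightarrow>
     (complex^'n^'n) set \<Rightarrow> 'n cproj \<Rightarrow> complex^'n^'n" where
  "gradient_map ip \<mu> \<aa> z =
     (THE \<xi>. \<xi> \<in> \<aa> \<and> (\<forall>\<beta>\<in>\<aa>. ip_isu ip \<xi> \<beta> = - ip (\<mu> z) (imul \<beta>)))"


section \<open>The group \<open>A = exp(\<aa>)\<close>\<close>

definition orbit :: "(complex^'n^'n) set \<Rightarrow> ('n::finite) cproj \<Rightarrow> 'n cproj set" where
  "orbit A x = (\<lambda>g. pact g x) ` A"

definition fixed_points :: "(complex^'n^'n) set \<Rightarrow> ('n::finite) cproj set \<Rightarrow> 'n cproj set" where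
  "fixed_points A X = {x\<in>X. \<forall>g\<in>A. pact g x = x}"

end

theory Submission
  imports Defs "HOL-Complex_Analysis.Cauchy_Integral_Formula"
begin

text \<open>
  Simultaneous diagonalization of \<open>\<aa>\<close> gives an orthonormal basis of joint eigenvectors \<open>e\<close>; the
  eigenvalues are functionals on \<open>\<aa>\<close>, represented there by weights. The equation for \<open>d\<mu>\<close> alone
  shows that \<open>\<mu>\<^sub>\<aa>[v]\<close> is the average, with masses \<open>(v \<bullet> e)\<^sup>2 / |v|\<^sup>2\<close>, of the image
  of the weights under one affine map (the integration constant of \<open>\<mu>\<close> is a translation, which
  affects none of the claims). Writing \<open>wt v\<close> for the images of the weights that occur in \<open>v\<close>, one has
  \<open>\<mu>\<^sub>\<aa>(closure (A [v])) = conv (wt v)\<close>: interior points of the hull are reached by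
  minimizing a coercive sum of exponentials. Since \<open>X\<close> is analytic and connected, each weight either
  occurs nowhere on \<open>X\<close> or on an open dense set, so a generic point of \<open>X\<close> has the largest possible
  set \<open>J\<close> of weights and \<open>\<mu>\<^sub>\<aa>(X) = conv J\<close>. A face is exposed by some \<open>\<xi> \<in> \<aa>\<close>, and the
  limit of \<open>exp (t \<xi>) x\<close> for \<open>t \<rightarrow> \<infinity>\<close> at a generic \<open>x\<close> carries exactly the weights in that face.
\<close>

section \<open>Commuting self-adjoint operators\<close>

text \<open>Everything runs over the reals: \<open>E\<close> is orthonormal for the real inner
  product of \<open>complex^'n\<close>, so every joint eigenspace, being complex, contributes at
  least two basis vectors with the same weight. One coordinate \<open>v \<bullet> e\<close> may
  vanish at \<open>v\<close> but not at \<open>c *s v\<close>; only the vanishing of all coordinates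
  of a weight is a condition on \<open>[v]\<close>. This is why points are described by sets of
  weights and why the identity theorem on \<open>X\<close> treats a block of coordinates at once.
  The scalar product \<open>ip\<close> is arbitrary, while weights are represented through the
  Euclidean inner product of matrices. A linear map converts one representation into the other; its
  injectivity on \<open>\<aa>\<close> keeps distinct weights distinct, which the fixed points at the
  vertices require. Convexity comes from a single orbit: for generic \<open>x\<close> the hull of
  \<open>J\<close> is the image of the closure of \<open>A x\<close>, which stays in the closed
  invariant set \<open>X\<close>. The orbit itself is shown to reach the combinations with positive
  coefficients; the boundary is caught by its closure, whose image is closed because projective
  space is compact.\<close>

text \<open>A maximum \<open>v\<close> of the quadratic form on the unit sphere of \<open>V\<close>
  works: varying \<open>v\<close> inside \<open>V\<close> shows that
  \<open>f v - l *\<^sub>R v\<close> is orthogonal to \<open>V\<close>, and invariance puts this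
  vector into \<open>V\<close>.\<close>

lemma linear_self_adjoint_eigenvector:
  fixes f :: "'a::euclidean_space \<Rightarrow> 'a"
  assumes lin: "linear f" and adj: "\<And>x y. f x \<bullet> y = x \<bullet> f y"
    and V: "subspace V" "V \<noteq> {0}" and inv: "f ` V \<subseteq> V"
  obtains v l where "v \<in> V" "v \<noteq> 0" "f v = l *\<^sub>R v"
proof -
  obtain u where u: "u \<in> V" "u \<noteq> 0"
    using V subspace_0 by blast
  have "u /\<^sub>R norm u \<in> V \<inter> sphere 0 1"
    using u V(1) by (simp add: subspace_scale)
  moreover have "compact (V \<inter> sphere 0 1)"
    using closed_subspace[OF V(1)] by (simp add: closed_Int_compact)
  moreover have "continuous_on (V \<inter> sphere 0 1) (\<lambda>x. f x \<bullet> x)"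
    by (intro continuous_intros linear_continuous_on lin linear_conv_bounded_linear[THEN iffD1])
  ultimately obtain v where v: "v \<in> V" "norm v = 1"
    and max: "\<And>x. x \<in> V \<inter> sphere 0 1 \<Longrightarrow> f x \<bullet> x \<le> f v \<bullet> v"
    using continuous_attains_sup[of "V \<inter> sphere 0 1" "\<lambda>x. f x \<bullet> x"] by fastforce
  define l where "l = f v \<bullet> v"
  have Q: "f x \<bullet> x \<le> l * (x \<bullet> x)" if "x \<in> V" for x
  proof (cases "x = 0")
    case False
    have "f (x /\<^sub>R norm x) \<bullet> (x /\<^sub>R norm x) \<le> l"
      unfolding l_def using False that V(1) by (intro max) (simp add: subspace_scale)
    then have "(f x \<bullet> x) / (norm x)\<^sup>2 \<le> l"
      by (simp add: linear_scale[OF lin] power2_eq_square divide_inverse mult.assoc mult.commute mult.left_commute)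
    then show ?thesis
      using False by (simp add: divide_le_eq power2_norm_eq_inner)
  qed (simp add: linear_0[OF lin])
  have ortho: "(f v - l *\<^sub>R v) \<bullet> u = 0" if "u \<in> V" for u
  proof (rule ccontr)
    define d where "d = (f v - l *\<^sub>R v) \<bullet> u"
    define q where "q = l * (u \<bullet> u) - f u \<bullet> u"
    assume "(f v - l *\<^sub>R v) \<bullet> u \<noteq> 0"
    then have d: "d \<noteq> 0" by (simp add: d_def)
    have *: "2 * t * d \<le> t\<^sup>2 * q" for t
    proof -
      have "v \<bullet> v = 1" using v by (simp add: norm_eq_1)
      have "f (v + t *\<^sub>R u) \<bullet> (v + t *\<^sub>R u) \<le> l * ((v + t *\<^sub>R u) \<bullet> (v + t *\<^sub>R u))"
        using v that V(1) by (intro Q) (simp add: subspace_add subspace_scale)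
      moreover have "f u \<bullet> v = f v \<bullet> u" using adj[of u v] by (simp add: inner_commute)
      ultimately show ?thesis
        using \<open>v \<bullet> v = 1\<close>
        by (simp add: linear_add[OF lin] linear_scale[OF lin] d_def q_def inner_simps algebra_simps
            power2_eq_square inner_commute l_def)
    qed
    have "q \<ge> 0" unfolding q_def using Q[OF that] by simp
    \<comment> \<open>A step small enough for the first-order gain \<open>2 * t * d\<close> to beat
      the loss \<open>t\<^sup>2 * q\<close>; the \<open>+ 1\<close> covers
      \<open>q = 0\<close>.\<close>
    define t where "t = d / (q + 1)"
    have "2 * d\<^sup>2 / (q + 1) \<le> d\<^sup>2 / (q + 1) * (q / (q + 1))"
      using *[of t] by (simp add: t_def power2_eq_square)
    also have "\<dots> \<le> d\<^sup>2 / (q + 1) * 1"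
      using \<open>q \<ge> 0\<close> by (intro mult_left_mono) auto
    finally show False using d \<open>q \<ge> 0\<close> by (simp add: divide_simps)
  qed
  have "f v - l *\<^sub>R v \<in> V"
    using v inv V(1) by (auto intro!: subspace_diff subspace_scale)
  from ortho[OF this] have "f v = l *\<^sub>R v" by simp
  moreover have "v \<noteq> 0" using v by auto
  ultimately show thesis using v that by blast
qed

text \<open>If every \<open>f\<close> is scalar on \<open>V\<close>, any orthonormal basis will do.
  Otherwise an eigenspace of a non-scalar \<open>f\<close> is a proper nonzero subspace, invariant
  under \<open>F\<close> by commutation; its orthogonal complement in \<open>V\<close> is invariant
  by self-adjointness, and induction on the dimension applies to both.\<close>

lemma commuting_self_adjoint_eigenbasis:
  fixes F :: "('a::euclidean_space \<Rightarrow> 'a) set"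
  assumes lin: "\<And>f. f \<in> F \<Longrightarrow> linear f"
    and adj: "\<And>f x y. f \<in> F \<Longrightarrow> f x \<bullet> y = x \<bullet> f y"
    and comm: "\<And>f g x. f \<in> F \<Longrightarrow> g \<in> F \<Longrightarrow> f (g x) = g (f x)"
    and V: "subspace V" and inv: "\<And>f. f \<in> F \<Longrightarrow> f ` V \<subseteq> V"
  shows "\<exists>B\<subseteq>V. pairwise orthogonal B \<and> (\<forall>b\<in>B. norm b = 1) \<and> span B = V \<and>
           (\<forall>b\<in>B. \<forall>f\<in>F. \<exists>l. f b = l *\<^sub>R b)"
  using V inv
proof (induction "dim V" arbitrary: V rule: less_induct)
  case less
  show ?case
  proof (cases "\<forall>f\<in>F. \<exists>l. \<forall>v\<in>V. f v = l *\<^sub>R v")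
    case True
    obtain B where "B \<subseteq> V" "pairwise orthogonal B" "\<And>x. x \<in> B \<Longrightarrow> norm x = 1" "span B = V"
      using orthonormal_basis_subspace[OF less.prems(1)] by metis
    moreover from this have "\<forall>b\<in>B. \<forall>f\<in>F. \<exists>l. f b = l *\<^sub>R b"
      using True by blast
    ultimately show ?thesis by blast
  next
    case False
    then obtain f where f: "f \<in> F" "\<And>l. \<exists>v\<in>V. f v \<noteq> l *\<^sub>R v" by auto
    have "V \<noteq> {0}" using f(2)[of 0] linear_0[OF lin[OF f(1)]] by auto
    then obtain v l where v: "v \<in> V" "v \<noteq> 0" "f v = l *\<^sub>R v"
      using linear_self_adjoint_eigenvector[OF lin[OF f(1)] adj[OF f(1)] less.prems(1) _ less.prems(2)[OF f(1)]] by metis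
    define W where "W = {x\<in>V. f x = l *\<^sub>R x}"
    define U where "U = {x\<in>V. \<forall>y\<in>W. x \<bullet> y = 0}"
    note lf = lin[OF f(1)]
    have sW: "subspace W"
      using less.prems(1)
      by (auto simp: W_def subspace_def linear_0[OF lf] linear_add[OF lf] linear_scale[OF lf] algebra_simps)
    have sU: "subspace U"
      using less.prems(1) by (auto simp: U_def subspace_def inner_simps)
    have WV: "W \<subseteq> V" and UV: "U \<subseteq> V" by (auto simp: W_def U_def)
    have "W \<noteq> V" using f(2)[of l] by (auto simp: W_def)
    then have dW: "dim W < dim V"
      using WV sW less.prems(1) by (metis dim_subset order.not_eq_order_implies_strict subspace_dim_equal order_refl)
    have "v \<in> W" using v by (auto simp: W_def)
    then have "v \<notin> U" using v(2) by (auto simp: U_def intro!: bexI[of _ v])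
    then have "U \<noteq> V" using v by auto
    then have dU: "dim U < dim V"
      using UV sU less.prems(1) by (metis dim_subset order.not_eq_order_implies_strict subspace_dim_equal order_refl)
    have iW: "g ` W \<subseteq> W" if "g \<in> F" for g
      using that less.prems(2)[OF that] comm[OF f(1) that] linear_scale[OF lin[OF that]]
      by (auto simp: W_def)
    have iU: "g ` U \<subseteq> U" if "g \<in> F" for g
      using that less.prems(2)[OF that] iW[OF that] adj[OF that]
      by (auto simp: U_def image_subset_iff)
    obtain B1 where B1: "B1 \<subseteq> W" "pairwise orthogonal B1" "\<forall>b\<in>B1. norm b = 1" "span B1 = W"
        "\<forall>b\<in>B1. \<forall>f\<in>F. \<exists>l. f b = l *\<^sub>R b"
      using less.hyps[OF dW sW iW] by blast
    obtain B2 where B2: "B2 \<subseteq> U" "pairwise orthogonal B2" "\<forall>b\<in>B2. norm b = 1" "span B2 = U"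
        "\<forall>b\<in>B2. \<forall>f\<in>F. \<exists>l. f b = l *\<^sub>R b"
      using less.hyps[OF dU sU iU] by blast
    have "span (B1 \<union> B2) = V"
    proof
      show "span (B1 \<union> B2) \<subseteq> V"
        using B1(1) B2(1) WV UV less.prems(1) by (intro span_minimal) auto
      show "V \<subseteq> span (B1 \<union> B2)"
      proof
        fix x assume "x \<in> V"
        obtain y z where yz: "y \<in> span W" "\<And>w. w \<in> span W \<Longrightarrow> orthogonal z w" "x = y + z"
          using orthogonal_subspace_decomp_exists[of W x] by metis
        have "y \<in> W" using yz(1) sW by (metis span_eq_iff)
        have "z = x - y" using yz(3) by simp
        then have "z \<in> V" using \<open>x \<in> V\<close> \<open>y \<in> W\<close> WV less.prems(1) by (auto intro: subspace_diff)
        then have "z \<in> U" using yz(2) by (auto simp: U_def orthogonal_def span_base)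
        have "y \<in> span (B1 \<union> B2)" "z \<in> span (B1 \<union> B2)"
          using \<open>y \<in> W\<close> \<open>z \<in> U\<close> B1(4) B2(4) span_mono[of B1 "B1 \<union> B2"] span_mono[of B2 "B1 \<union> B2"] by auto
        then show "x \<in> span (B1 \<union> B2)" using yz(3) by (simp add: span_add)
      qed
    qed
    moreover have "pairwise orthogonal (B1 \<union> B2)"
    proof -
      have "orthogonal x y \<and> orthogonal y x" if "x \<in> B1" "y \<in> B2" for x y
      proof -
        have "x \<in> W" "y \<in> U" using that B1(1) B2(1) by auto
        then show ?thesis by (simp add: U_def orthogonal_def inner_commute)
      qed
      then show ?thesis using B1(2) B2(2) unfolding pairwise_def by blast
    qed
    ultimately show ?thesis
      using B1 B2 WV UV by (intro exI[of _ "B1 \<union> B2"]) auto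
  qed
qed

lemma orthonormal_expansion:
  fixes x :: "'a::euclidean_space"
  assumes "pairwise orthogonal B" "\<And>b. b \<in> B \<Longrightarrow> norm b = 1" "x \<in> span B"
  shows "(\<Sum>b\<in>B. (x \<bullet> b) *\<^sub>R b) = x"
proof -
  have fin: "finite B" using assms(1) by (rule pairwise_orthogonal_imp_finite)
  have "(b \<bullet> b) = 1" if "b \<in> B" for b using assms(2)[OF that] by (simp add: norm_eq_1)
  then have "(\<Sum>b\<in>B. (b \<bullet> x) *\<^sub>R b) = (\<Sum>b\<in>B. (b \<bullet> x / (b \<bullet> b)) *\<^sub>R b)"
    by (intro sum.cong) auto
  moreover have "orthogonal (x - (\<Sum>b\<in>B. (b \<bullet> x / (b \<bullet> b)) *\<^sub>R b)) y" if "y \<in> span B" for y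
    using Gram_Schmidt_step[OF assms(1) that, of x] by (simp add: orthogonal_commute)
  moreover have "x - (\<Sum>b\<in>B. (b \<bullet> x) *\<^sub>R b) \<in> span B"
    using assms(3) by (intro span_diff span_sum span_scale) (auto intro: span_base)
  ultimately have "x - (\<Sum>b\<in>B. (b \<bullet> x) *\<^sub>R b) = 0"
    by (metis orthogonal_self)
  then show ?thesis by (simp add: inner_commute)
qed

section \<open>Representing functionals and scalar products on a subspace\<close>

text \<open>Riesz representation. Linearity is asked on \<open>V\<close> only, because
  \<open>ip\<close> is bilinear on \<open>su\<close> and arbitrary elsewhere.\<close>

lemma linear_functional_on_subspace_inner:
  fixes f :: "'a::euclidean_space \<Rightarrow> real"
  assumes V: "subspace V"
    and add: "\<And>x y. x \<in> V \<Longrightarrow> y \<in> V \<Longrightarrow> f (x + y) = f x + f y"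
    and scale: "\<And>r x. x \<in> V \<Longrightarrow> f (r *\<^sub>R x) = r * f x"
  obtains w where "w \<in> V" "\<And>x. x \<in> V \<Longrightarrow> f x = w \<bullet> x"
proof -
  obtain B where B: "B \<subseteq> V" "pairwise orthogonal B" "\<And>x. x \<in> B \<Longrightarrow> norm x = 1" "span B = V"
    using orthonormal_basis_subspace[OF V] by metis
  define w where "w = (\<Sum>b\<in>B. f b *\<^sub>R b)"
  have f0: "f 0 = 0" using scale[of 0 0] V subspace_0 by auto
  have fsum: "f (\<Sum>b\<in>C. g b *\<^sub>R b) = (\<Sum>b\<in>C. g b * f b)" if "finite C" "C \<subseteq> V" for g C
    using that
  proof induction
    case (insert x C)
    then have "(\<Sum>b\<in>C. g b *\<^sub>R b) \<in> V"
      using V by (auto intro!: subspace_sum subspace_scale)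
    then show ?case using insert by (simp add: add scale V subspace_scale)
  qed (simp add: f0)
  have "f x = w \<bullet> x" if "x \<in> V" for x
  proof -
    have "f x = f (\<Sum>b\<in>B. (x \<bullet> b) *\<^sub>R b)"
      using orthonormal_expansion[OF B(2,3)] that B(4) by simp
    also have "\<dots> = (\<Sum>b\<in>B. (x \<bullet> b) * f b)"
      using pairwise_orthogonal_imp_finite[OF B(2)] B(1) by (rule fsum)
    also have "\<dots> = w \<bullet> x"
      by (simp add: w_def inner_sum_left inner_commute[of x] mult.commute)
    finally show ?thesis .
  qed
  moreover have "w \<in> V" unfolding w_def using B V by (auto intro!: subspace_sum subspace_scale)
  ultimately show thesis using that by blast
qed

text \<open>\<open>T\<close> is the orthogonal projection to \<open>V\<close> followed by the
  inverse of the Gram operator of \<open>q\<close>. It turns a vector representing a functional for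
  the Euclidean product into the one representing it for \<open>q\<close>.\<close>

lemma scalar_product_representation:
  fixes q :: "'a::euclidean_space \<Rightarrow> 'a \<Rightarrow> real"
  assumes V: "subspace V"
    and add: "\<And>x y z. x \<in> V \<Longrightarrow> y \<in> V \<Longrightarrow> z \<in> V \<Longrightarrow> q (x + y) z = q x z + q y z"
    and scale: "\<And>r x y. x \<in> V \<Longrightarrow> y \<in> V \<Longrightarrow> q (r *\<^sub>R x) y = r * q x y"
    and sym: "\<And>x y. x \<in> V \<Longrightarrow> y \<in> V \<Longrightarrow> q x y = q y x"
    and pos: "\<And>x. x \<in> V \<Longrightarrow> x \<noteq> 0 \<Longrightarrow> q x x > 0"
  obtains T where "linear T" "inj_on T V" "\<And>y. T y \<in> V" "\<And>y x. x \<in> V \<Longrightarrow> q (T y) x = y \<bullet> x"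
proof -
  have "\<exists>w. w \<in> V \<and> (\<forall>z\<in>V. q x z = w \<bullet> z)" if "x \<in> V" for x
    by (rule linear_functional_on_subspace_inner[OF V, of "q x"])
       (use that V in \<open>auto simp: sym[OF that] add scale subspace_add subspace_scale\<close>)
  then obtain G where G: "\<And>x. x \<in> V \<Longrightarrow> G x \<in> V" "\<And>x z. x \<in> V \<Longrightarrow> z \<in> V \<Longrightarrow> q x z = G x \<bullet> z"
    by metis
  have eqI: "x = y" if "x \<in> V" "y \<in> V" "\<And>z. z \<in> V \<Longrightarrow> x \<bullet> z = y \<bullet> z" for x y
  proof -
    have "(x - y) \<bullet> (x - y) = 0"
      using that V by (simp add: inner_diff_left subspace_diff)
    then show ?thesis by simp
  qed
  have Gadd: "G (x + y) = G x + G y" if "x \<in> V" "y \<in> V" for x y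
    by (rule eqI) (use that V G in \<open>auto simp: subspace_add inner_simps add simp flip: G(2)\<close>)
  have Gscale: "G (r *\<^sub>R x) = r *\<^sub>R G x" if "x \<in> V" for x r
    by (rule eqI) (use that V G in \<open>auto simp: subspace_scale inner_simps scale simp flip: G(2)\<close>)
  obtain P where P: "linear P" "\<And>x. P x \<in> V" "\<And>x. x \<in> V \<Longrightarrow> P x = x" "\<And>x z. z \<in> V \<Longrightarrow> P x \<bullet> z = x \<bullet> z"
  proof -
    obtain B where B: "B \<subseteq> V" "pairwise orthogonal B" "\<And>x. x \<in> B \<Longrightarrow> norm x = 1" "span B = V"
      using orthonormal_basis_subspace[OF V] by metis
    note exp = orthonormal_expansion[OF B(2,3)]
    have 1: "(\<Sum>b\<in>B. (x \<bullet> b) *\<^sub>R b) \<bullet> z = x \<bullet> z" if "z \<in> V" for x z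
    proof -
      have "x \<bullet> z = x \<bullet> (\<Sum>b\<in>B. (z \<bullet> b) *\<^sub>R b)" using exp[of z] that B(4) by simp
      then show ?thesis by (simp add: inner_sum_left inner_sum_right inner_commute mult.commute)
    qed
    show thesis
    proof (rule that[of "\<lambda>x. \<Sum>b\<in>B. (x \<bullet> b) *\<^sub>R b"])
      show "linear (\<lambda>x. \<Sum>b\<in>B. (x \<bullet> b) *\<^sub>R b)"
        by (intro linearI) (simp_all add: inner_simps scaleR_left_distrib sum.distrib scaleR_sum_right)
    qed (use 1 exp B V in \<open>auto intro!: subspace_sum subspace_scale\<close>)
  qed
  \<comment> \<open>The Gram operator on \<open>V\<close>, extended by the identity on the
    orthogonal complement: an injective linear map of the whole space, hence invertible.\<close>
  define H where "H x = G (P x) + (x - P x)" for x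
  have linH: "linear H"
    by (intro linearI)
       (simp_all add: H_def linear_add[OF P(1)] linear_scale[OF P(1)] Gadd Gscale P(2) algebra_simps)
  have "inj H"
  proof (rule linear_injective_0[OF linH, THEN iffD2], intro allI impI)
    fix x assume "H x = 0"
    have "G (P x) \<in> V" using G P by auto
    have "P (H x) = G (P x)"
      using P(3)[OF \<open>G (P x) \<in> V\<close>] P(3)[OF P(2)]
      by (simp add: H_def linear_add[OF P(1)] linear_diff[OF P(1)])
    then have "G (P x) = 0" using \<open>H x = 0\<close> linear_0[OF P(1)] by simp
    then have "q (P x) (P x) = 0" using G(2)[OF P(2) P(2)] by simp
    then have "P x = 0" using pos[OF P(2)[of x]] by force
    moreover have "x - P x = 0" using \<open>H x = 0\<close> \<open>G (P x) = 0\<close> by (simp add: H_def)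
    ultimately show "x = 0" by simp
  qed
  then obtain K where K: "linear K" "\<And>x. K (H x) = x" "\<And>x. H (K x) = x"
    using linear_injective_isomorphism[OF linH] by metis
  define T where "T y = K (P y)" for y
  have HG: "H x = G x" if "x \<in> V" for x using that P(3) by (simp add: H_def)
  have KV: "K y \<in> V" if "y \<in> V" for y
  proof -
    \<comment> \<open>\<open>H\<close> leaves the component orthogonal to \<open>V\<close>
      unchanged, so that component of \<open>K y\<close> is the one of \<open>y\<close>, which is
      zero.\<close>
    have "K y - P (K y) = H (K y) - P (H (K y))"
      using P(3)[OF G(1)[OF P(2)]] P(3)[OF P(2)]
      by (simp add: H_def linear_add[OF P(1)] linear_diff[OF P(1)])
    also have "\<dots> = 0" using that P(3) K(3) by simp
    finally show ?thesis using P(2)[of "K y"] by simp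
  qed
  show thesis
  proof (rule that[of T])
    show "linear T" unfolding T_def using linear_compose[OF P(1) K(1)] by (simp add: o_def)
    show "inj_on T V" by (rule inj_onI) (metis K(3) P(3) T_def)
    show "T y \<in> V" for y by (simp add: T_def KV P(2))
    show "q (T y) x = y \<bullet> x" if "x \<in> V" for x y
    proof -
      have "q (T y) x = H (T y) \<bullet> x" using that HG G KV P by (simp add: T_def)
      then show ?thesis using that by (simp add: T_def K(3) P(4))
    qed
  qed
qed


section \<open>Power series along lines and critical points of exponential sums\<close>

text \<open>Points near which \<open>h\<close> vanishes identically form an open set. Around any
  other point of the interval \<open>h\<close> has at most an isolated zero, so such points are open
  too, and connectedness of the interval decides.\<close>

lemma real_identity_theorem_interval:
  fixes h :: "real \<Rightarrow> real"
  assumes ps: "\<And>t. t \<in> {0..1} \<Longrightarrow> \<exists>r>0. \<exists>a. \<forall>s. \<bar>s - t\<bar> < r \<longrightarrow> (\<lambda>n. a n * (s - t) ^ n) sums h s"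
    and zero: "\<exists>\<epsilon>>0. \<forall>s. \<bar>s\<bar> < \<epsilon> \<longrightarrow> h s = 0"
    and t: "t \<in> {0..1}"
  shows "h t = 0"
proof -
  define P where "P t \<longleftrightarrow> (\<exists>\<epsilon>>0. \<forall>s. \<bar>s - t\<bar> < \<epsilon> \<longrightarrow> h s = 0)" for t
  have "open {t. P t}"
  proof (clarsimp simp: open_dist dist_real_def)
    fix t assume "P t"
    then obtain \<epsilon> where e: "\<epsilon> > 0" "\<And>s. \<bar>s - t\<bar> < \<epsilon> \<Longrightarrow> h s = 0" by (auto simp: P_def)
    show "\<exists>e>0. \<forall>y. \<bar>y - t\<bar> < e \<longrightarrow> P y"
    proof (intro exI[of _ "\<epsilon> / 2"] conjI allI impI)
      fix y assume "\<bar>y - t\<bar> < \<epsilon> / 2"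
      then have "\<forall>s. \<bar>s - y\<bar> < \<epsilon> / 2 \<longrightarrow> h s = 0" by (intro allI impI e(2)) linarith
      then show "P y" using e(1) unfolding P_def by (intro exI[of _ "\<epsilon> / 2"]) auto
    qed (use e in auto)
  qed
  have nonP: "\<exists>e>0. \<forall>y. \<bar>y - t\<bar> < e \<longrightarrow> \<not> P y" if t: "t \<in> {0..1}" "\<not> P t" for t
  proof -
    obtain r a where r: "r > 0" and a: "\<And>s. \<bar>s - t\<bar> < r \<Longrightarrow> (\<lambda>n. a n * (s - t) ^ n) sums h s"
      using ps[OF t(1)] by blast
    have "\<exists>e>0. \<forall>s. s \<noteq> t \<and> \<bar>s - t\<bar> < e \<longrightarrow> h s \<noteq> 0"
    proof (cases "h t = 0")
      case True
      have "(\<lambda>n. a n * 0 ^ n) sums h t" using a[of t] r by simp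
      then have a0: "a 0 = 0" using True powser_sums_zero_iff by fastforce
      have "\<exists>m>0. a m \<noteq> 0"
      proof (rule ccontr)
        assume "\<not> (\<exists>m>0. a m \<noteq> 0)"
        then have "a = (\<lambda>n. 0)" using a0 by (metis gr0I)
        then have "\<forall>s. \<bar>s - t\<bar> < r \<longrightarrow> h s = 0"
          using a sums_unique2[OF _ sums_zero] by fastforce
        then show False using t(2) r by (auto simp: P_def)
      qed
      then obtain m where m: "m > 0" "a m \<noteq> 0" by blast
      obtain s where s: "0 < s" "\<And>z. z \<in> cball t s - {t} \<Longrightarrow> h z \<noteq> 0"
        using powser_0_nonzero[of r t a h m] r a True m by auto
      show ?thesis using s by (intro exI[of _ s]) (auto simp: dist_real_def)
    next
      case False
      have "(\<lambda>n. a n * 0 ^ n) sums h t" using a[of t] r by simp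
      then have a0: "a 0 = h t" using powser_sums_zero_iff by fastforce
      have "((\<lambda>x. h (x + t)) \<longlongrightarrow> a 0) (at 0)"
      proof (rule powser_limit_0_strong[OF r])
        show "(\<lambda>n. a n * x ^ n) sums h (x + t)" if "norm x < r" for x
          using a[of "x + t"] that by simp
      qed
      then have "\<forall>\<^sub>F x in at 0. h (x + t) \<noteq> 0"
        using False a0 by (intro tendsto_imp_eventually_ne) auto
      then obtain d where d: "d > 0" "\<And>x. x \<noteq> 0 \<Longrightarrow> \<bar>x\<bar> < d \<Longrightarrow> h (x + t) \<noteq> 0"
        by (auto simp: eventually_at dist_real_def)
      show ?thesis
      proof (intro exI[of _ d] conjI allI impI)
        fix s assume "s \<noteq> t \<and> \<bar>s - t\<bar> < d"
        then show "h s \<noteq> 0" using d(2)[of "s - t"] by simp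
      qed (use d in auto)
    qed
    then obtain e where e: "e > 0" "\<And>s. s \<noteq> t \<Longrightarrow> \<bar>s - t\<bar> < e \<Longrightarrow> h s \<noteq> 0" by blast
    have "\<not> P y" if "\<bar>y - t\<bar> < e" for y
    proof
      assume "P y"
      then have "y \<noteq> t" using t(2) by auto
      moreover have "h y = 0" using \<open>P y\<close> by (auto simp: P_def)
      ultimately show False using e(2) that by blast
    qed
    then show ?thesis using e(1) by blast
  qed
  \<comment> \<open>The expansions are centred in the interval only, so the complement of
    \<open>P\<close> need not be open on the whole line. \<open>W\<close> is an open set that avoids
    \<open>P\<close> and covers the rest of the interval.\<close>
  define W where "W = (\<Union>{ball t e |t e. \<forall>y\<in>ball t e. \<not> P y})"
  have "open W" unfolding W_def by auto
  have WP: "W \<inter> {t. P t} = {}" unfolding W_def by auto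
  have "{0..1} \<subseteq> {t. P t} \<union> W"
  proof
    fix t :: real assume t: "t \<in> {0..1}"
    show "t \<in> {t. P t} \<union> W"
    proof (cases "P t")
      case False
      obtain e where "e > 0" "\<forall>y. \<bar>y - t\<bar> < e \<longrightarrow> \<not> P y"
        using nonP[OF t False] by blast
      then have "t \<in> ball t e" "\<forall>y\<in>ball t e. \<not> P y" by (auto simp: dist_real_def abs_minus_commute)
      then show ?thesis unfolding W_def by blast
    qed auto
  qed
  moreover have "0 \<in> {t. P t} \<inter> {0..1::real}" using zero by (auto simp: P_def)
  ultimately have "W \<inter> {0..1} = {}"
    using connectedD[OF connected_Icc \<open>open {t. P t}\<close> \<open>open W\<close>, of 0 1] WP by blast
  then have "P t" using \<open>{0..1} \<subseteq> {t. P t} \<union> W\<close> t by blast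
  then show ?thesis by (auto simp: P_def)
qed

text \<open>On a line through the centre every monomial of total degree \<open>n\<close> becomes a
  multiple of \<open>s ^ n\<close>. There are finitely many of each degree, so collecting them
  yields a power series in one variable.\<close>

lemma real_analytic_on_line:
  fixes f :: "'a::euclidean_space \<Rightarrow> 'b::euclidean_space"
  assumes an: "real_analytic_on f S" and aS: "a \<in> S"
    and line: "\<exists>\<epsilon>>0. \<forall>s. \<bar>s\<bar> < \<epsilon> \<longrightarrow> a + s *\<^sub>R d \<in> S"
  shows "\<exists>r>0. \<exists>c. \<forall>s. \<bar>s\<bar> < r \<longrightarrow> (\<lambda>n. c n * s ^ n) sums (f (a + s *\<^sub>R d) \<bullet> e)"
proof -
  obtain \<epsilon> where eps: "\<epsilon> > 0" "\<And>s. \<bar>s\<bar> < \<epsilon> \<Longrightarrow> a + s *\<^sub>R d \<in> S" using line by blast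
  define M where "M = {\<alpha> :: 'a \<Rightarrow> nat. \<forall>b. b \<notin> Basis \<longrightarrow> \<alpha> b = 0}"
  obtain k r where r: "r > 0" and k: "\<And>x. x \<in> S \<inter> ball a r \<Longrightarrow>
      ((\<lambda>\<alpha>. (\<Prod>b\<in>Basis. ((x - a) \<bullet> b) ^ \<alpha> b) *\<^sub>R k \<alpha>) has_sum f x) M"
    using an aS unfolding real_analytic_on_def M_def by blast
  define deg where "deg \<alpha> = sum \<alpha> Basis" for \<alpha> :: "'a \<Rightarrow> nat"
  define D where "D n = {\<alpha>\<in>M. deg \<alpha> = n}" for n
  define m where "m \<alpha> = (\<Prod>b\<in>Basis. (d \<bullet> b) ^ \<alpha> b) * (k \<alpha> \<bullet> e)" for \<alpha>
  have finD: "finite (D n)" for n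
  proof (rule finite_subset)
    show "D n \<subseteq> {\<alpha>. \<forall>b. (b \<in> Basis \<longrightarrow> \<alpha> b \<in> {..n}) \<and> (b \<notin> Basis \<longrightarrow> \<alpha> b = 0)}"
      unfolding D_def M_def deg_def by (auto intro: member_le_sum)
    show "finite {\<alpha>. \<forall>b::'a. (b \<in> Basis \<longrightarrow> \<alpha> b \<in> {..n}) \<and> (b \<notin> Basis \<longrightarrow> \<alpha> b = 0)}"
      by (intro finite_set_of_finite_funs) auto
  qed
  define c where "c n = sum m (D n)" for n
  \<comment> \<open>Keeps \<open>a + s *\<^sub>R d\<close> in \<open>S\<close> and in the ball of
    convergence; the \<open>+ 1\<close> allows \<open>d = 0\<close>.\<close>
  define \<rho> where "\<rho> = min \<epsilon> (r / (norm d + 1))"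
  have "(\<lambda>n. c n * s ^ n) sums (f (a + s *\<^sub>R d) \<bullet> e)" if s: "\<bar>s\<bar> < \<rho>" for s
  proof -
    have "\<bar>s\<bar> * norm d \<le> \<bar>s\<bar> * (norm d + 1)" by (simp add: mult_left_mono)
    also have "\<dots> < r" using s by (simp add: \<rho>_def pos_less_divide_eq add_nonneg_pos)
    finally have "a + s *\<^sub>R d \<in> S \<inter> ball a r"
      using eps(2)[of s] s by (simp add: \<rho>_def dist_norm)
    from has_sum_bounded_linear[OF bounded_linear_inner_left[of e] k[OF this]]
    have "((\<lambda>\<alpha>. (\<Prod>b\<in>Basis. (s * (d \<bullet> b)) ^ \<alpha> b) * (k \<alpha> \<bullet> e)) has_sum (f (a + s *\<^sub>R d) \<bullet> e)) M"
      by simp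
    also have "(\<lambda>\<alpha>. (\<Prod>b\<in>Basis. (s * (d \<bullet> b)) ^ \<alpha> b) * (k \<alpha> \<bullet> e)) = (\<lambda>\<alpha>. m \<alpha> * s ^ deg \<alpha>)"
      by (simp add: m_def deg_def power_mult_distrib prod.distrib power_sum fun_eq_iff)
    finally have 1: "((\<lambda>\<alpha>. m \<alpha> * s ^ deg \<alpha>) has_sum (f (a + s *\<^sub>R d) \<bullet> e)) M" .
    \<comment> \<open>Unconditional summability allows the regrouping by degree.\<close>
    have "((\<lambda>(n,\<alpha>). m \<alpha> * s ^ n) has_sum (f (a + s *\<^sub>R d) \<bullet> e)) (Sigma UNIV D)"
      using 1
      by (subst has_sum_reindex_bij_witness[where i = "\<lambda>\<alpha>. (deg \<alpha>, \<alpha>)" and j = snd and T = M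
             and h = "\<lambda>\<alpha>. m \<alpha> * s ^ deg \<alpha>"]) (auto simp: D_def)
    then have "((\<lambda>n. c n * s ^ n) has_sum (f (a + s *\<^sub>R d) \<bullet> e)) UNIV"
    proof (rule has_sum_SigmaD)
      show "((\<lambda>\<alpha>. case (n, \<alpha>) of (n, \<alpha>) \<Rightarrow> m \<alpha> * s ^ n) has_sum c n * s ^ n) (D n)" for n
        using has_sum_finite[OF finD[of n], of "\<lambda>\<alpha>. m \<alpha> * s ^ n"]
        by (simp add: c_def sum_distrib_right)
    qed
    then show ?thesis by (rule has_sum_imp_sums)
  qed
  moreover have "\<rho> > 0" using eps r by (simp add: \<rho>_def add_nonneg_pos)
  ultimately show ?thesis by blast
qed

section \<open>Barycentres of exponential masses\<close>

text \<open>The masses \<open>a i * exp (w i \<bullet> x)\<close> can be tuned to have any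
  prescribed barycentre \<open>q\<close> that is a strictly positive combination of the
  \<open>w i\<close>. With \<open>u i = w i - q\<close> the sum of
  \<open>a i * exp (u i \<bullet> x)\<close> is coercive on the span of the \<open>u i\<close>;
  vanishing of its gradient at a minimum is the claim, up to the common factor
  \<open>exp (q \<bullet> x)\<close>.\<close>

lemma exp_sum_critical_point:
  fixes w :: "'i \<Rightarrow> 'a::euclidean_space"
  assumes I: "finite I" "I \<noteq> {}" and t: "\<And>i. i \<in> I \<Longrightarrow> t i > 0" "sum t I = 1"
    and a: "\<And>i. i \<in> I \<Longrightarrow> a i > 0" and q: "q = (\<Sum>i\<in>I. t i *\<^sub>R w i)"
  obtains x where "x \<in> span (w ` I)" "(\<Sum>i\<in>I. (a i * exp (w i \<bullet> x)) *\<^sub>R (w i - q)) = 0"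
proof -
  define u where "u i = w i - q" for i
  define V where "V = span (u ` I)"
  have V: "subspace V" by (simp add: V_def)
  have uV: "u i \<in> V" if "i \<in> I" for i using that by (simp add: V_def span_base)
  have tu: "(\<Sum>i\<in>I. t i *\<^sub>R u i) = 0"
    using t(2) by (simp add: u_def scaleR_diff_right sum_subtractf q flip: scaleR_sum_left)
  define G where "G x = (\<Sum>i\<in>I. a i * exp (u i \<bullet> x))" for x
  have contG: "continuous_on S G" for S unfolding G_def by (intro continuous_intros)
  \<comment> \<open>Strict positivity of \<open>t\<close> enters here: the \<open>u i\<close> have
    weighted sum zero, so if none pairs positively with \<open>x\<close>, all pair to zero and
    \<open>x\<close> is orthogonal to \<open>V\<close>.\<close>
  have pos: "\<exists>i\<in>I. u i \<bullet> x > 0" if "x \<in> V" "x \<noteq> 0" for x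
  proof (rule ccontr)
    assume "\<not> ?thesis"
    then have le: "\<And>i. i \<in> I \<Longrightarrow> u i \<bullet> x \<le> 0" by force
    have "(\<Sum>i\<in>I. t i * (- (u i \<bullet> x))) = 0"
      using arg_cong[OF tu, of "\<lambda>y. y \<bullet> x"] by (simp add: inner_sum_left sum_negf)
    then have "\<forall>i\<in>I. t i * (- (u i \<bullet> x)) = 0"
      using le t(1) I(1) by (subst (asm) sum_nonneg_eq_0_iff) (auto simp: mult_le_0_iff less_imp_le)
    then have 0: "\<And>i. i \<in> I \<Longrightarrow> u i \<bullet> x = 0" using t(1) by force
    have "y \<bullet> x = 0" if "y \<in> V" for y
      using that unfolding V_def
      by (induction rule: span_induct_alt) (auto simp: inner_simps 0)
    then have "x \<bullet> x = 0" using \<open>x \<in> V\<close> by blast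
    then show False using \<open>x \<noteq> 0\<close> by simp
  qed
  have GI: "a i * exp (u i \<bullet> x) \<le> G x" if "i \<in> I" for i x
    unfolding G_def using that I(1) a by (intro member_le_sum) (auto intro: less_imp_le)
  obtain x where x: "x \<in> V" "\<And>y. y \<in> V \<Longrightarrow> G x \<le> G y"
  proof (cases "V = {0}")
    case False
    define Sp where "Sp = V \<inter> sphere 0 1"
    have compS: "compact Sp"
      unfolding Sp_def using closed_subspace[OF V] by (simp add: closed_Int_compact)
    obtain z where "z \<in> V" "z \<noteq> 0" using False V subspace_0 by blast
    then have neS: "z /\<^sub>R norm z \<in> Sp"
      using V by (simp add: Sp_def subspace_scale)
    have contS: "continuous_on Sp (\<lambda>x. \<Sum>i\<in>I. max 0 (u i \<bullet> x))"
      by (intro continuous_intros)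
    obtain x0 where x0: "x0 \<in> Sp" "\<And>y. y \<in> Sp \<Longrightarrow> (\<Sum>i\<in>I. max 0 (u i \<bullet> x0)) \<le> (\<Sum>i\<in>I. max 0 (u i \<bullet> y))"
      using continuous_attains_inf[OF compS _ contS] neS by auto
    \<comment> \<open>Division by the number of indices turns the lower bound for the sum of
      positive parts into a bound attained by a single one of them.\<close>
    define \<delta> where "\<delta> = (\<Sum>i\<in>I. max 0 (u i \<bullet> x0)) / card I"
    have cI: "card I > 0" using I by (simp add: card_gt_0_iff)
    have "\<delta> > 0"
    proof -
      have "x0 \<in> V" "x0 \<noteq> 0" using x0(1) by (auto simp: Sp_def)
      then obtain i where "i \<in> I" "u i \<bullet> x0 > 0" using pos by blast
      then have "(\<Sum>i\<in>I. max 0 (u i \<bullet> x0)) > 0" using I(1) by (intro sum_pos2[of I i]) auto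
      then show ?thesis using cI by (simp add: \<delta>_def)
    qed
    have big: "\<exists>i\<in>I. u i \<bullet> y \<ge> \<delta> * norm y" if "y \<in> V" "y \<noteq> 0" for y
    proof (rule ccontr)
      assume "\<not> ?thesis"
      then have lt: "\<And>i. i \<in> I \<Longrightarrow> u i \<bullet> y < \<delta> * norm y" by force
      have "y /\<^sub>R norm y \<in> Sp" using that V by (simp add: Sp_def subspace_scale)
      from x0(2)[OF this] have "card I * \<delta> \<le> (\<Sum>i\<in>I. max 0 (u i \<bullet> (y /\<^sub>R norm y)))"
        using cI by (simp add: \<delta>_def)
      also have "\<dots> < (\<Sum>i\<in>I. \<delta>)"
        using I lt that \<open>\<delta> > 0\<close> by (intro sum_strict_mono) (auto simp: field_simps)
      finally show False by simp
    qed
    define a0 where "a0 = Min (a ` I)"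
    have a0: "a0 > 0" "\<And>i. i \<in> I \<Longrightarrow> a0 \<le> a i" using I a by (auto simp: a0_def)
    \<comment> \<open>Chosen so that \<open>a0 * exp (\<delta> * R) \<ge> G 0\<close>: beyond radius
      \<open>R\<close> one summand alone exceeds the value at the origin, so a minimum over the ball
      is global. The \<open>+ 1\<close> makes \<open>R\<close> positive.\<close>
    define R where "R = \<bar>ln (G 0 / a0)\<bar> / \<delta> + 1"
    have G0: "G 0 > 0" unfolding G_def using I a by (intro sum_pos) auto
    have far: "G 0 \<le> G y" if "y \<in> V" "norm y > R" for y
    proof -
      have "R > 0" using \<open>\<delta> > 0\<close> by (simp add: R_def add_nonneg_pos)
      then have "y \<noteq> 0" using that by auto
      then obtain i where i: "i \<in> I" "u i \<bullet> y \<ge> \<delta> * norm y" using big[OF \<open>y \<in> V\<close>] by blast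
      have "ln (G 0 / a0) \<le> \<delta> * R" using \<open>\<delta> > 0\<close> by (simp add: R_def distrib_left)
      also have "\<dots> \<le> u i \<bullet> y" using i(2) that(2) \<open>\<delta> > 0\<close> by (smt (verit) mult_left_mono)
      finally have "G 0 / a0 \<le> exp (u i \<bullet> y)" using G0 a0(1) by (metis divide_pos_pos exp_le_cancel_iff exp_ln)
      then have "G 0 \<le> a0 * exp (u i \<bullet> y)" using a0 by (simp add: pos_divide_le_eq mult.commute)
      also have "\<dots> \<le> a i * exp (u i \<bullet> y)" using a0(2)[OF i(1)] by simp
      also have "\<dots> \<le> G y" by (rule GI[OF i(1)])
      finally show ?thesis .
    qed
    have "compact (V \<inter> cball 0 R)" using closed_subspace[OF V] by (simp add: closed_Int_compact)
    moreover have R0: "0 \<in> V \<inter> cball 0 R" using V subspace_0 \<open>\<delta> > 0\<close> by (auto simp: R_def add_nonneg_nonneg)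
    ultimately obtain x where x: "x \<in> V \<inter> cball 0 R" "\<And>y. y \<in> V \<inter> cball 0 R \<Longrightarrow> G x \<le> G y"
      using continuous_attains_inf[OF _ _ contG, of "V \<inter> cball 0 R"] by blast
    show thesis
    proof (rule that[of x])
      show "G x \<le> G y" if "y \<in> V" for y
        using x(2)[of y] x(2)[OF R0] far[OF that] that by (cases "norm y \<le> R") auto
    qed (use x in auto)
  qed auto
  \<comment> \<open>The gradient of \<open>G\<close> at the minimum. It lies in \<open>V\<close>, so
    moving along it is allowed, and the derivative in this direction is its squared norm.\<close>
  define g where "g = (\<Sum>i\<in>I. (a i * exp (u i \<bullet> x)) *\<^sub>R u i)"
  have gV: "g \<in> V" unfolding g_def using uV V by (auto intro!: subspace_sum subspace_scale)
  have "((\<lambda>s. G (x + s *\<^sub>R g)) has_real_derivative (g \<bullet> g)) (at 0)"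
  proof -
    have "((\<lambda>s. G (x + s *\<^sub>R g)) has_real_derivative (\<Sum>i\<in>I. a i * (exp (u i \<bullet> x) * (u i \<bullet> g)))) (at 0)"
      unfolding G_def inner_add_right inner_scaleR_right
      by (auto intro!: derivative_eq_intros sum.cong)
    also have "(\<Sum>i\<in>I. a i * (exp (u i \<bullet> x) * (u i \<bullet> g))) = g \<bullet> g"
      by (subst (3) g_def) (simp add: inner_sum_right mult.assoc inner_commute[of g])
    finally show ?thesis .
  qed
  then have "g \<bullet> g = 0"
    by (rule DERIV_local_min[where d = 1]) (use x gV V in \<open>auto intro!: x(2) subspace_add subspace_scale\<close>)
  then have g0: "g = 0" by simp
  have "(\<Sum>i\<in>I. (a i * exp (w i \<bullet> x)) *\<^sub>R (w i - q)) = exp (q \<bullet> x) *\<^sub>R g"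
    unfolding g_def u_def scaleR_sum_right
    by (intro sum.cong) (simp_all add: inner_diff_left exp_diff)
  moreover have "x \<in> span (w ` I)"
  proof -
    have "V \<subseteq> span (w ` I)"
      unfolding V_def u_def q
      by (rule span_minimal) (auto intro!: span_diff span_sum span_scale intro: span_base)
    then show ?thesis using x(1) by blast
  qed
  ultimately show thesis using that g0 by simp
qed


section \<open>Projective space and analytic submanifolds\<close>

lemma norm_scalar_mult_complex: "norm (c *s v) = cmod c * norm (v :: complex^'n)"
  by (simp add: norm_vec_def norm_mult L2_set_right_distrib)

lemma scaleR_eq_scalar_mult_complex: "r *\<^sub>R v = complex_of_real r *s (v :: complex^'n)"
  by (simp add: vec_eq_iff) (simp add: scaleR_conv_of_real)

lemma proj_scale:
  assumes "c \<noteq> 0"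
  shows "proj (c *s v) = proj v"
proof -
  have "range (\<lambda>k. k *s (c *s v)) = range (\<lambda>k. k *s v)"
  proof
    show "range (\<lambda>k. k *s v) \<subseteq> range (\<lambda>k. k *s (c *s v))"
    proof clarify
      fix k
      have "k *s v = (k / c) *s (c *s v)" using assms by simp
      then show "k *s v \<in> range (\<lambda>k. k *s (c *s v))" by blast
    qed
  qed auto
  then show ?thesis by (simp add: proj_def)
qed

lemma proj_scaleR: "r \<noteq> 0 \<Longrightarrow> proj (r *\<^sub>R v) = proj v"
  by (simp add: scaleR_eq_scalar_mult_complex proj_scale)

lemma proj_eqD:
  assumes "v \<noteq> 0" "w \<noteq> 0" "proj v = proj w"
  obtains c where "c \<noteq> 0" "w = c *s v"
proof -
  have "w \<in> range (\<lambda>c. c *s w)" using rangeI[of "\<lambda>c. c *s w" 1] by simp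
  also have "\<dots> = range (\<lambda>c. c *s v)" using assms line_of_proj by metis
  finally obtain c where "w = c *s v" by blast
  then show thesis using that assms by (metis vector_smult_lzero)
qed

lemma cproj_lift:
  assumes "\<And>c u. c \<noteq> 0 \<Longrightarrow> u \<noteq> 0 \<Longrightarrow> F (c *s u) = F u"
  obtains f where "\<And>u. u \<noteq> 0 \<Longrightarrow> f (proj u) = F u"
proof (rule that)
  fix u :: "complex^'a" assume u: "u \<noteq> 0"
  define u' where "u' = (SOME u'. u' \<noteq> 0 \<and> proj u = proj u')"
  have "u' \<noteq> 0 \<and> proj u = proj u'"
    unfolding u'_def by (rule someI[of _ u]) (use u in simp)
  then obtain c where "c \<noteq> 0" "u' = c *s u" using u proj_eqD by metis
  then show "(\<lambda>z. F (SOME u. u \<noteq> 0 \<and> z = proj u)) (proj u) = F u"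
    using assms u by (simp add: u'_def)
qed

lemma continuous_on_proj: "continuous_on (- {0}) proj"
proof -
  have "proj -` B \<inter> - {0} = {v. v \<noteq> 0 \<and> proj v \<in> B}" for B :: "'a cproj set" by auto
  then show ?thesis
    by (subst continuous_on_open_vimage) (auto simp: open_cproj_def)
qed

lemma continuous_on_cproj:
  fixes f :: "('n::finite) cproj \<Rightarrow> 'b::topological_space"
  assumes "continuous_on (- {0}) (\<lambda>v. f (proj v))"
  shows "continuous_on UNIV f"
proof -
  have "open (f -` B)" if "open B" for B
  proof -
    have "open ((\<lambda>v. f (proj v)) -` B \<inter> - {0})"
      using assms that by (subst (asm) continuous_on_open_vimage) auto
    also have "(\<lambda>v. f (proj v)) -` B \<inter> - {0} = {v. v \<noteq> 0 \<and> proj v \<in> f -` B}" by auto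
    finally show ?thesis by (simp add: open_cproj_def)
  qed
  then show ?thesis by (simp add: continuous_on_open_vimage)
qed

text \<open>The rank-one projector \<open>v v\<^sup>* / |v|\<^sup>2\<close> embeds projective space into the matrices.\<close>

instance cproj :: (finite) t2_space
proof
  fix x y :: "'a cproj" assume "x \<noteq> y"
  define F where "F v = (\<chi> i j. v $ i * cnj (v $ j) / complex_of_real ((norm v)\<^sup>2))" for v :: "complex^'a"
  have hom: "F (c *s u) = F u" if "c \<noteq> 0" for c u
  proof -
    have "c * a * (cnj c * b) / complex_of_real ((cmod c * n)\<^sup>2) = a * b / complex_of_real (n\<^sup>2)" for a b n
    proof -
      have "c * a * (cnj c * b) = (a * b) * (complex_of_real (cmod c))\<^sup>2"
        using complex_norm_square[of c] by (simp add: mult_ac)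
      then show ?thesis using that by (simp only: of_real_power of_real_mult power_mult_distrib) simp
    qed
    then show ?thesis by (simp add: F_def norm_scalar_mult_complex)
  qed
  obtain f where f: "\<And>u. u \<noteq> 0 \<Longrightarrow> f (proj u) = F u"
    using cproj_lift[of F] hom by metis
  have cont: "continuous_on UNIV f"
  proof (rule continuous_on_cproj)
    have "continuous_on (- {0}) F"
      unfolding F_def
      by (intro continuous_on_vec_lambda continuous_intros continuous_on_component) auto
    then show "continuous_on (- {0}) (\<lambda>v. f (proj v))"
      by (rule continuous_on_eq) (simp add: f)
  qed
  obtain v where v: "v \<noteq> 0" "x = proj v" by (rule proj_cases)
  obtain w where w: "w \<noteq> 0" "y = proj w" by (rule proj_cases)
  have "f x \<noteq> f y"
  proof
    assume "f x = f y"
    then have "F v = F w" using v w f by simp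
    obtain j where j: "w $ j \<noteq> 0" using w by (auto simp: vec_eq_iff)
    \<comment> \<open>Found by solving the equality of the two projectors in column \<open>j\<close>
      for \<open>w $ i\<close>.\<close>
    define c where "c = cnj (v $ j) * (norm w)\<^sup>2 / ((norm v)\<^sup>2 * cnj (w $ j))"
    have "w $ i = c * v $ i" for i
    proof -
      have "w $ i * cnj (w $ j) / complex_of_real ((norm w)\<^sup>2) = v $ i * cnj (v $ j) / complex_of_real ((norm v)\<^sup>2)"
        using arg_cong[OF \<open>F v = F w\<close>, of "\<lambda>m. m $ i $ j"] by (simp add: F_def)
      then show ?thesis using j v w by (simp add: c_def field_simps)
    qed
    then have "w = c *s v" by (simp add: vec_eq_iff)
    moreover from this have "c \<noteq> 0" using w by auto
    ultimately show False using \<open>x \<noteq> y\<close> v w proj_scale by metis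
  qed
  then obtain U V where UV: "open U" "open V" "f x \<in> U" "f y \<in> V" "U \<inter> V = {}"
    by (meson hausdorff)
  then have "open (f -` U)" "open (f -` V)"
    using cont by (simp_all add: continuous_on_open_vimage)
  then show "\<exists>U V. open U \<and> open V \<and> x \<in> U \<and> y \<in> V \<and> U \<inter> V = {}"
    using UV by (intro exI[of _ "f -` U"] exI[of _ "f -` V"]) auto
qed

lemma compact_UNIV_cproj: "compact (UNIV :: ('n::finite) cproj set)"
proof -
  have "compact (proj ` sphere (0 :: complex^'n) 1)"
    by (intro compact_continuous_image continuous_on_subset[OF continuous_on_proj]) auto
  moreover have "proj ` sphere (0 :: complex^'n) 1 = UNIV"
  proof -
    have "z \<in> proj ` sphere (0 :: complex^'n) 1" for z
    proof -
      obtain v where v: "v \<noteq> 0" "z = proj v" by (rule proj_cases)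
      then have "z = proj (v /\<^sub>R norm v)" by (simp add: proj_scaleR)
      then show ?thesis using v by auto
    qed
    then show ?thesis by auto
  qed
  ultimately show ?thesis by simp
qed

text \<open>The cone over \<open>U\<close> is the preimage of an ambient open set under the
  normalization of the \<open>i\<close>-th coordinate to 1, which is continuous where that
  coordinate is nonzero.\<close>

lemma open_proj_image_affine_chart:
  fixes U :: "(complex^'n::finite) set"
  assumes "openin (top_of_set {w. w $ i = 1}) U"
  shows "open (proj ` U)"
proof -
  obtain W where W: "open W" "U = {w. w $ i = 1} \<inter> W"
    using assms by (auto simp: openin_open)
  have "continuous_on {v :: complex^'n. v $ i \<noteq> 0} (\<lambda>v. (1 / v $ i) *s v)"
    unfolding vector_scalar_mult_def
    by (intro continuous_on_vec_lambda continuous_intros continuous_on_component) auto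
  moreover have "open {v :: complex^'n. v $ i \<noteq> 0}"
    by (intro open_Collect_neq continuous_intros continuous_on_component)
  ultimately have "open ((\<lambda>v. (1 / v $ i) *s v) -` W \<inter> {v. v $ i \<noteq> 0})"
    using W(1) by (simp add: continuous_on_open_vimage)
  also have "(\<lambda>v. (1 / v $ i) *s v) -` W \<inter> {v. v $ i \<noteq> 0} = {v. v \<noteq> 0 \<and> proj v \<in> proj ` U}"
  proof (intro equalityI subsetI)
    fix v assume v: "v \<in> (\<lambda>v. (1 / v $ i) *s v) -` W \<inter> {v. v $ i \<noteq> 0}"
    then have "(1 / v $ i) *s v \<in> U" by (simp add: W(2))
    moreover have "proj ((1 / v $ i) *s v) = proj v" using v by (intro proj_scale) auto
    ultimately have "proj v \<in> proj ` U" by (metis imageI)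
    then show "v \<in> {v. v \<noteq> 0 \<and> proj v \<in> proj ` U}" using v by auto
  next
    fix v assume "v \<in> {v. v \<noteq> 0 \<and> proj v \<in> proj ` U}"
    then obtain u where v: "v \<noteq> 0" "proj v = proj u" "u \<in> U" by auto
    then have u: "u $ i = 1" "u \<in> W" by (auto simp: W(2))
    then have "u \<noteq> 0" by auto
    then obtain c where c: "c \<noteq> 0" "u = c *s v" using v proj_eqD by metis
    then have "c * v $ i = 1" using u by simp
    then have "v $ i \<noteq> 0" by auto
    then have "1 / v $ i = c" using \<open>c * v $ i = 1\<close> by (simp add: field_simps)
    then show "v \<in> (\<lambda>v. (1 / v $ i) *s v) -` W \<inter> {v. v $ i \<noteq> 0}" using c u \<open>v $ i \<noteq> 0\<close> by auto
  qed
  finally show ?thesis by (simp add: open_cproj_def)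
qed

section \<open>Identity theorem on a connected analytic submanifold\<close>

text \<open>By \<open>inv\<close>, common vanishing of the coordinates in \<open>B\<close> is a
  property of points. The points near which all of \<open>X\<close> has it form a relatively open
  and closed set \<open>N\<close>: in a chart, vanishing spreads along segments by the one-variable
  identity theorem.\<close>

lemma analytic_submanifold_cproj_identity:
  fixes X :: "('n::finite) cproj set" and B :: "(complex^'n) set"
  assumes an: "analytic_submanifold_cproj X" and conn: "connected X"
    and inv: "\<And>c v. c \<noteq> 0 \<Longrightarrow> \<forall>e\<in>B. v \<bullet> e = 0 \<Longrightarrow> \<forall>e\<in>B. (c *s v) \<bullet> e = 0"
    and U: "open U" "X \<inter> U \<noteq> {}" "\<And>v. v \<noteq> 0 \<Longrightarrow> proj v \<in> X \<inter> U \<Longrightarrow> \<forall>e\<in>B. v \<bullet> e = 0"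
    and v: "v \<noteq> 0" "proj v \<in> X"
  shows "\<forall>e\<in>B. v \<bullet> e = 0"
proof -
  define Z where "Z = {proj v |v. v \<noteq> 0 \<and> (\<forall>e\<in>B. v \<bullet> e = 0)}"
  have Z: "proj v \<in> Z \<longleftrightarrow> (\<forall>e\<in>B. v \<bullet> e = 0)" if v0: "v \<noteq> 0" for v
  proof
    assume "proj v \<in> Z"
    then obtain u where u: "u \<noteq> 0" "\<forall>e\<in>B. u \<bullet> e = 0" "proj v = proj u"
      unfolding Z_def by blast
    then obtain c where "c \<noteq> 0" "v = c *s u" using proj_eqD v0 by metis
    then show "\<forall>e\<in>B. v \<bullet> e = 0" using inv u(2) by blast
  next
    assume "\<forall>e\<in>B. v \<bullet> e = 0"
    then show "proj v \<in> Z" using v0 unfolding Z_def by blast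
  qed
  define N where "N = {x\<in>X. \<exists>U. open U \<and> x \<in> U \<and> X \<inter> U \<subseteq> Z}"
  \<comment> \<open>Gives closedness of \<open>N\<close>: a point outside \<open>N\<close> has a
    neighbourhood disjoint from \<open>N\<close>, since otherwise \<open>X\<close> would have the
    property throughout that neighbourhood.\<close>
  have local: "\<exists>O'. open O' \<and> x \<in> O' \<and> (O' \<inter> N \<noteq> {} \<longrightarrow> X \<inter> O' \<subseteq> Z)" if x: "x \<in> X" for x
  proof -
    obtain u where u: "u \<noteq> 0" "x = proj u" by (rule proj_cases)
    obtain i where i: "u $ i \<noteq> 0" using u(1) by (auto simp: vec_eq_iff)
    define H where "H = {w :: complex^'n. w $ i = 1}"
    define M where "M = {w :: complex^'n. w $ i = 1 \<and> proj w \<in> X}"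
    define w0 where "w0 = (1 / u $ i) *s u"
    have w0: "proj w0 = x" "w0 \<in> M" using i u x by (auto simp: w0_def M_def proj_scale)
    have "analytic_submanifold_in H M"
      using an unfolding analytic_submanifold_cproj_def H_def M_def by blast
    from this[unfolded analytic_submanifold_in_def, THEN conjunct2, rule_format, OF w0(2)]
    obtain U V \<phi> \<psi> L where ch: "openin (top_of_set H) U" "w0 \<in> U" "openin (top_of_set H) V"
        "homeomorphism U V \<phi> \<psi>" "real_analytic_on \<psi> V" "affine L" "\<phi> ` (M \<inter> U) = V \<inter> L"
      by (elim exE conjE)
    note hom = homeomorphism_cont1[OF ch(4)] homeomorphism_cont2[OF ch(4)]
      homeomorphism_apply1[OF ch(4)] homeomorphism_apply2[OF ch(4)]
      homeomorphism_image1[OF ch(4)] homeomorphism_image2[OF ch(4)]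
    define a where "a = \<phi> w0"
    obtain Vo where Vo: "open Vo" "V = H \<inter> Vo" using ch(3) by (auto simp: openin_open)
    have "a \<in> V" using ch(2) hom(5) by (auto simp: a_def)
    then obtain \<rho> where rho: "\<rho> > 0" "ball a \<rho> \<subseteq> Vo" using Vo openE by blast
    \<comment> \<open>Shrinking to the preimage of a ball makes the chart image of \<open>X\<close>
      convex, as the ball is intersected with the affine sets \<open>H\<close> and
      \<open>L\<close>.\<close>
    define U' where "U' = {w\<in>U. \<phi> w \<in> ball a \<rho>}"
    have "U' = U \<inter> \<phi> -` ball a \<rho>" by (auto simp: U'_def)
    then have "openin (top_of_set U) U'" using hom(1) by (simp add: continuous_openin_preimage_gen)
    then have U'H: "openin (top_of_set H) U'" using ch(1) openin_trans by blast
    have "affine H"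
      by (auto simp: affine_def H_def simp flip: scaleR_add_left)
    have affHL: "p + s *\<^sub>R (q - p) \<in> H \<inter> L" if "p \<in> H \<inter> L" "q \<in> H \<inter> L" for p q s
    proof -
      have "p + s *\<^sub>R (q - p) = (1 - s) *\<^sub>R p + s *\<^sub>R q" by (simp add: algebra_simps)
      then show ?thesis using affine_Int[OF \<open>affine H\<close> ch(6)] that unfolding affine_def
        by (metis diff_add_cancel)
    qed
    have psiM: "\<psi> y \<in> M \<inter> U \<and> \<phi> (\<psi> y) = y" if y: "y \<in> V \<inter> L" for y
    proof -
      obtain w where "w \<in> M \<inter> U" "y = \<phi> w" using y ch(7) by blast
      then show ?thesis using hom(3) by auto
    qed
    have Mnz: "w \<noteq> 0" if "w \<in> M" for w using that by (auto simp: M_def)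
    have "X \<inter> proj ` U' \<subseteq> Z" if meet: "proj ` U' \<inter> N \<noteq> {}"
    proof -
      obtain w1 where w1: "w1 \<in> U'" "proj w1 \<in> N" using meet by auto
      then obtain U1 where U1: "open U1" "proj w1 \<in> U1" "X \<inter> U1 \<subseteq> Z" by (auto simp: N_def)
      have UH: "U \<subseteq> H" using ch(1) openin_imp_subset by blast
      have inMU: "w \<in> M \<inter> U" if "w \<in> U'" "proj w \<in> X" for w
        using that UH by (auto simp: U'_def H_def M_def)
      have w1M: "w1 \<in> M \<inter> U" using inMU w1 by (auto simp: N_def)
      define y1 where "y1 = \<phi> w1"
      have y1: "y1 \<in> V \<inter> L" "y1 \<in> ball a \<rho>" using w1M ch(7) w1 by (auto simp: y1_def U'_def)
      have "w \<bullet> e = 0" if wU: "w \<in> U'" "proj w \<in> X" and e: "e \<in> B" for w e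
      proof -
        define y where "y = \<phi> w"
        have y: "y \<in> V \<inter> L" "y \<in> ball a \<rho>" using inMU[OF wU] ch(7) wU by (auto simp: y_def U'_def)
        \<comment> \<open>The whole line through \<open>y1\<close> and \<open>y\<close>, not only
          the segment: the expansions at the endpoints are two-sided and need the open parameter set
          \<open>I\<close>.\<close>
        define p where "p s = y1 + s *\<^sub>R (y - y1)" for s
        have pHL: "p s \<in> H \<inter> L" for s unfolding p_def using y y1 Vo by (intro affHL) auto
        have pV: "p s \<in> V \<inter> L" if "p s \<in> ball a \<rho>" for s using pHL that Vo rho by auto
        have contp: "continuous_on S p" for S unfolding p_def by (intro continuous_intros)
        define I where "I = p -` ball a \<rho>"
        have "open I" unfolding I_def using contp open_vimage by blast
        have pI: "p ` I \<subseteq> V \<inter> L" using pV by (auto simp: I_def)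
        have seg: "{0..1} \<subseteq> I"
        proof
          fix s :: real assume "s \<in> {0..1}"
          then have "(1 - s) *\<^sub>R y1 + s *\<^sub>R y \<in> ball a \<rho>"
            using y y1 convex_ball[of a \<rho>] by (intro convexD) auto
          then show "s \<in> I" by (simp add: I_def p_def algebra_simps)
        qed
        have "\<psi> (p 1) \<bullet> e = 0"
        proof (rule real_identity_theorem_interval[of "\<lambda>s. \<psi> (p s) \<bullet> e"])
          fix t :: real assume "t \<in> {0..1}"
          then have "t \<in> I" using seg by blast
          then obtain \<epsilon> where eps: "\<epsilon> > 0" "ball t \<epsilon> \<subseteq> I" using \<open>open I\<close> openE by blast
          have ps: "p t + s *\<^sub>R (y - y1) = p (t + s)" for s by (simp add: p_def algebra_simps)
          have "\<exists>r>0. \<exists>c. \<forall>s. \<bar>s\<bar> < r \<longrightarrow> (\<lambda>n. c n * s ^ n) sums (\<psi> (p t + s *\<^sub>R (y - y1)) \<bullet> e)"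
          proof (rule real_analytic_on_line[OF ch(5)])
            show "p t \<in> V" using pI \<open>t \<in> I\<close> by auto
            have "p (t + s) \<in> V" if "\<bar>s\<bar> < \<epsilon>" for s
            proof -
              have "t + s \<in> I" using eps(2) that by (auto simp: subset_iff dist_real_def)
              then show ?thesis using pI by auto
            qed
            then show "\<exists>\<epsilon>>0. \<forall>s. \<bar>s\<bar> < \<epsilon> \<longrightarrow> p t + s *\<^sub>R (y - y1) \<in> V"
              using eps(1) by (auto simp: ps)
          qed
          then obtain r c where rc: "r > 0" "\<And>s. \<bar>s\<bar> < r \<Longrightarrow> (\<lambda>n. c n * s ^ n) sums (\<psi> (p (t + s)) \<bullet> e)"
            by (auto simp: ps)
          have "(\<lambda>n. c n * (s - t) ^ n) sums (\<psi> (p s) \<bullet> e)" if "\<bar>s - t\<bar> < r" for s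
            using rc(2)[OF that] by simp
          then show "\<exists>r>0. \<exists>a. \<forall>s. \<bar>s - t\<bar> < r \<longrightarrow> (\<lambda>n. a n * (s - t) ^ n) sums (\<psi> (p s) \<bullet> e)"
            using rc(1) by blast
        next
          \<comment> \<open>By continuity the curve stays in the neighbourhood \<open>U1\<close> of
            its starting point for small \<open>s\<close>, where \<open>X\<close> is known to have
            the vanishing property.\<close>
          have "continuous_on I (\<lambda>s. proj (\<psi> (p s)))"
          proof (rule continuous_on_compose2[OF continuous_on_proj])
            show "continuous_on I (\<lambda>s. \<psi> (p s))"
              by (rule continuous_on_compose2[OF hom(2) contp]) (use pI in auto)
            show "(\<lambda>s. \<psi> (p s)) ` I \<subseteq> - {0}"
            proof clarify
              fix s assume "s \<in> I" "\<psi> (p s) = 0"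
              moreover from this have "\<psi> (p s) \<in> M" using psiM[of "p s"] pI by auto
              ultimately show False using Mnz by auto
            qed
          qed
          then have "open ((\<lambda>s. proj (\<psi> (p s))) -` U1 \<inter> I)"
            using \<open>open I\<close> U1(1) by (simp add: continuous_on_open_vimage)
          moreover have "p 0 = y1" by (simp add: p_def)
          then have "0 \<in> (\<lambda>s. proj (\<psi> (p s))) -` U1 \<inter> I"
            using U1(2) w1M hom(3) seg by (auto simp: y1_def)
          ultimately obtain \<epsilon> where eps: "\<epsilon> > 0" "ball 0 \<epsilon> \<subseteq> (\<lambda>s. proj (\<psi> (p s))) -` U1 \<inter> I"
            using openE by blast
          have "\<psi> (p s) \<bullet> e = 0" if "\<bar>s\<bar> < \<epsilon>" for s
          proof -
            have s: "s \<in> I" "proj (\<psi> (p s)) \<in> U1" using eps(2) that by (auto simp: subset_iff)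
            then have "\<psi> (p s) \<in> M" using psiM[of "p s"] pI by auto
            then show ?thesis using U1(3) s Z[OF Mnz] e by (auto simp: M_def)
          qed
          then show "\<exists>\<epsilon>>0. \<forall>s. \<bar>s\<bar> < \<epsilon> \<longrightarrow> \<psi> (p s) \<bullet> e = 0" using eps(1) by blast
        qed auto
        moreover have "\<psi> (p 1) = w" using hom(3) inMU[OF wU] by (simp add: p_def y_def)
        ultimately show ?thesis by simp
      qed
      moreover have "w \<noteq> 0" if "w \<in> U'" "proj w \<in> X" for w
        using Mnz inMU[OF that] by blast
      ultimately show ?thesis using Z by auto
    qed
    moreover have "x \<in> proj ` U'" using w0 ch(2) rho(1) by (auto simp: U'_def a_def)
    moreover have "open (proj ` U')" using open_proj_image_affine_chart U'H by (simp add: H_def)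
    ultimately show ?thesis by blast
  qed
  have "openin (top_of_set X) N"
  proof (subst openin_subopen, intro ballI)
    fix x assume "x \<in> N"
    then obtain U where U: "open U" "x \<in> U" "X \<inter> U \<subseteq> Z" by (auto simp: N_def)
    then have "X \<inter> U \<subseteq> N" by (auto simp: N_def)
    then show "\<exists>T. openin (top_of_set X) T \<and> x \<in> T \<and> T \<subseteq> N"
      using U \<open>x \<in> N\<close> by (intro exI[of _ "X \<inter> U"]) (auto simp: N_def)
  qed
  moreover have "openin (top_of_set X) (X - N)"
  proof (subst openin_subopen, intro ballI)
    fix x assume x: "x \<in> X - N"
    then obtain O' where O': "open O'" "x \<in> O'" "O' \<inter> N \<noteq> {} \<longrightarrow> X \<inter> O' \<subseteq> Z" using local by blast
    then have "O' \<inter> N = {}" using x by (auto simp: N_def)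
    then show "\<exists>T. openin (top_of_set X) T \<and> x \<in> T \<and> T \<subseteq> X - N"
      using O' x by (intro exI[of _ "X \<inter> O'"]) auto
  qed
  then have "closedin (top_of_set X) N" by (auto simp: closedin_def N_def)
  ultimately have "N = {} \<or> N = X" using conn by (simp add: connected_clopen)
  moreover have "X \<inter> U \<subseteq> Z"
  proof
    fix x assume x: "x \<in> X \<inter> U"
    obtain u where u: "u \<noteq> 0" "x = proj u" by (rule proj_cases)
    then show "x \<in> Z" using U(3) x Z by auto
  qed
  then have "X \<inter> U \<subseteq> N" using U(1) by (auto simp: N_def)
  ultimately have "proj v \<in> N" using U(2) v by auto
  then show ?thesis using Z v by (auto simp: N_def)
qed

text \<open>Openness keeps density alive: the part of \<open>S\<close> inside the previous
  intersection is relatively open and nonempty, so the next dense set meets it.\<close>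

lemma openin_dense_Int_finite:
  fixes X :: "'a::topological_space set"
  assumes "finite J" "\<And>j. j \<in> J \<Longrightarrow> openin (top_of_set X) (D j) \<and> X \<subseteq> closure (D j)"
  shows "openin (top_of_set X) (X \<inter> (\<Inter>j\<in>J. D j)) \<and> X \<subseteq> closure (X \<inter> (\<Inter>j\<in>J. D j))"
  using assms
proof induction
  case empty
  then show ?case using closure_subset by auto
next
  case (insert j J)
  let ?G = "X \<inter> (\<Inter>j\<in>J. D j)"
  have G: "openin (top_of_set X) ?G" "X \<subseteq> closure ?G" and D: "openin (top_of_set X) (D j)" "X \<subseteq> closure (D j)"
    using insert by auto
  have eq: "X \<inter> (\<Inter>j\<in>insert j J. D j) = D j \<inter> ?G" using openin_imp_subset[OF D(1)] by auto
  have "x \<in> closure (D j \<inter> ?G)" if "x \<in> X" for x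
    unfolding closure_iff_nhds_not_empty
  proof (intro allI impI)
    fix A S assume S: "S \<subseteq> A" "open S" "x \<in> S"
    obtain G' where G': "open G'" "?G = X \<inter> G'" using G(1) by (auto simp: openin_open)
    have "?G \<inter> S \<noteq> {}" using G(2) that S unfolding closure_iff_nhds_not_empty subset_iff by blast
    then obtain y where "y \<in> X" "y \<in> G' \<inter> S" using G' by auto
    moreover have "open (G' \<inter> S)" using G' S by auto
    ultimately have "D j \<inter> (G' \<inter> S) \<noteq> {}" using D(2) unfolding closure_iff_nhds_not_empty subset_iff by blast
    then show "D j \<inter> ?G \<inter> A \<noteq> {}" using G' S openin_imp_subset[OF D(1)] by auto
  qed
  then show ?case unfolding eq using G(1) D(1) by (auto intro: openin_Int)
qed


section \<open>Orbits and weights\<close>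

text \<open>The diagonalized situation: \<open>V\<close> stands for \<open>\<aa>\<close>,
  \<open>act\<close> for the matrix exponential, \<open>m\<close> for the gradient map.
  \<open>w e\<close> represents the eigenvalue on \<open>e\<close> as a functional on
  \<open>V\<close>. The assumption \<open>scalar\<close> records that weight spaces are complex and
  mutually orthogonal. \<open>T\<close> and \<open>k\<close> form the affine map from weights to
  their positions in the image.\<close>

locale weight_basis =
  fixes E :: "(complex^'n::finite) set"
    and w :: "complex^'n \<Rightarrow> 'b::euclidean_space"
    and V :: "'b set"
    and act :: "'b \<Rightarrow> complex^'n^'n"
    and T :: "'b \<Rightarrow> 'b" and k :: 'b
    and m :: "'n cproj \<Rightarrow> 'b"
  assumes E_orth: "pairwise orthogonal E" and E_unit: "\<And>e. e \<in> E \<Longrightarrow> norm e = 1"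
    and E_span: "span E = UNIV"
    and V: "subspace V" and w_in: "\<And>e. e \<in> E \<Longrightarrow> w e \<in> V"
    and act: "\<And>\<xi> e. \<xi> \<in> V \<Longrightarrow> e \<in> E \<Longrightarrow> act \<xi> *v e = exp (w e \<bullet> \<xi>) *\<^sub>R e"
    and scalar: "\<And>c e e'. e \<in> E \<Longrightarrow> e' \<in> E \<Longrightarrow> w e \<noteq> w e' \<Longrightarrow> (c *s e) \<bullet> e' = 0"
    and T_linear: "linear T" and T_inj: "inj_on T V"
    and m: "\<And>v. v \<noteq> 0 \<Longrightarrow> m (proj v) = (\<Sum>e\<in>E. ((v \<bullet> e)\<^sup>2 / (v \<bullet> v)) *\<^sub>R (T (w e) + k))"
begin

definition vertex :: "complex^'n \<Rightarrow> 'b" where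
  "vertex e = T (w e) + k"

definition wt :: "complex^'n \<Rightarrow> 'b set" where
  "wt v = vertex ` {e\<in>E. v \<bullet> e \<noteq> 0}"

lemma finite_E: "finite E"
  using E_orth by (rule pairwise_orthogonal_imp_finite)

lemma finite_wt: "finite (wt v)"
  using finite_E by (simp add: wt_def)

lemma vertex_eq_iff: "e \<in> E \<Longrightarrow> e' \<in> E \<Longrightarrow> vertex e = vertex e' \<longleftrightarrow> w e = w e'"
  using inj_on_eq_iff[OF T_inj w_in w_in] by (simp add: vertex_def)

lemma expansion: "(\<Sum>e\<in>E. (v \<bullet> e) *\<^sub>R e) = v"
  using orthonormal_expansion[OF E_orth E_unit] E_span by simp

lemma parseval: "(\<Sum>e\<in>E. (v \<bullet> e)\<^sup>2) = v \<bullet> v"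
proof -
  have "(\<Sum>e\<in>E. (v \<bullet> e)\<^sup>2) = v \<bullet> (\<Sum>e\<in>E. (v \<bullet> e) *\<^sub>R e)"
    by (simp add: inner_sum_right power2_eq_square)
  then show ?thesis by (simp only: expansion)
qed

lemma inner_sum_E:
  assumes "e' \<in> E"
  shows "(\<Sum>e\<in>E. f e *\<^sub>R e) \<bullet> e' = f e'"
proof -
  have "(\<Sum>e\<in>E. f e *\<^sub>R e) \<bullet> e' = (\<Sum>e\<in>E. if e = e' then f e else 0)"
    unfolding inner_sum_left
  proof (intro sum.cong refl)
    fix e assume "e \<in> E"
    then show "f e *\<^sub>R e \<bullet> e' = (if e = e' then f e else 0)"
      using E_orth E_unit assms by (auto simp: pairwise_def orthogonal_def norm_eq_1)
  qed
  then show ?thesis using finite_E assms by simp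
qed

lemma act_expansion:
  assumes "\<xi> \<in> V"
  shows "act \<xi> *v v = (\<Sum>e\<in>E. (exp (w e \<bullet> \<xi>) * (v \<bullet> e)) *\<^sub>R e)"
proof -
  have lin: "linear ((*v) (act \<xi>))" by simp
  have "act \<xi> *v v = act \<xi> *v (\<Sum>e\<in>E. (v \<bullet> e) *\<^sub>R e)" by (simp add: expansion)
  also have "\<dots> = (\<Sum>e\<in>E. (v \<bullet> e) *\<^sub>R (act \<xi> *v e))"
    by (simp add: linear_sum[OF lin] linear_scale[OF lin])
  finally show ?thesis using act[OF assms] by (simp add: mult.commute)
qed

lemma inner_act: "\<xi> \<in> V \<Longrightarrow> e \<in> E \<Longrightarrow> (act \<xi> *v v) \<bullet> e = exp (w e \<bullet> \<xi>) * (v \<bullet> e)"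
  by (simp add: act_expansion inner_sum_E)

lemma wt_act: "\<xi> \<in> V \<Longrightarrow> wt (act \<xi> *v v) = wt v"
  unfolding wt_def using inner_act by (intro image_cong) auto

text \<open>By \<open>scalar\<close>, complex multiplication mixes only basis vectors of equal
  weight, so no new weight can appear.\<close>

lemma wt_scale_subset: "wt (c *s v) \<subseteq> wt v"
proof
  fix p assume "p \<in> wt (c *s v)"
  then obtain e' where e': "e' \<in> E" "(c *s v) \<bullet> e' \<noteq> 0" "p = vertex e'" by (auto simp: wt_def)
  have lin: "linear ((*s) c :: complex^'n \<Rightarrow> complex^'n)"
    by (intro linearI) (simp_all add: vec_eq_iff algebra_simps)
  have "c *s (\<Sum>e\<in>E. (v \<bullet> e) *\<^sub>R e) = (\<Sum>e\<in>E. (v \<bullet> e) *\<^sub>R (c *s e))"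
    by (simp only: linear_sum[OF lin] linear_scale[OF lin])
  then have "(c *s v) \<bullet> e' = (\<Sum>e\<in>E. (v \<bullet> e) * ((c *s e) \<bullet> e'))"
    by (simp only: expansion inner_sum_left inner_scaleR_left)
  then have "(\<Sum>e\<in>E. (v \<bullet> e) * ((c *s e) \<bullet> e')) \<noteq> 0" using e'(2) by simp
  then obtain e where e: "e \<in> E" "(v \<bullet> e) * ((c *s e) \<bullet> e') \<noteq> 0"
    by (rule sum.not_neutral_contains_not_neutral)
  then have "w e = w e'" using scalar[OF e(1) e'(1), of c] by auto
  then have "p = vertex e" using e' by (simp add: vertex_def)
  then show "p \<in> wt v" using e by (auto simp: wt_def)
qed

lemma wt_scale:
  assumes "c \<noteq> 0"
  shows "wt (c *s v) = wt v"
proof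
  have "wt ((1 / c) *s (c *s v)) \<subseteq> wt (c *s v)" by (rule wt_scale_subset)
  then show "wt v \<subseteq> wt (c *s v)" using assms by simp
qed (rule wt_scale_subset)

lemma wt_proj:
  assumes "v \<noteq> 0" "u \<noteq> 0" "proj v = proj u"
  shows "wt v = wt u"
proof -
  obtain c where "c \<noteq> 0" "u = c *s v" using assms by (rule proj_eqD)
  then show ?thesis by (simp add: wt_scale)
qed

text \<open>A weight that is present persists nearby; weights can be lost only in a limit. Both
  openness claims about generic points rest on this.\<close>

lemma open_wt: "open {v. p \<in> wt v}"
proof -
  have "{v. p \<in> wt v} = (\<Union>e\<in>{e\<in>E. vertex e = p}. {v. v \<bullet> e \<noteq> 0})" by (auto simp: wt_def)
  also have "open \<dots>" by (intro open_UN ballI open_Collect_neq continuous_intros)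
  finally show ?thesis .
qed

lemma wt_nonempty: "v \<noteq> 0 \<Longrightarrow> wt v \<noteq> {}"
proof
  assume "v \<noteq> 0" "wt v = {}"
  then have "\<And>e. e \<in> E \<Longrightarrow> v \<bullet> e = 0" by (auto simp: wt_def)
  then have "(\<Sum>e\<in>E. (v \<bullet> e) *\<^sub>R e) = 0" by simp
  then show False using expansion[of v] \<open>v \<noteq> 0\<close> by simp
qed

lemma act_nonzero: "\<xi> \<in> V \<Longrightarrow> v \<noteq> 0 \<Longrightarrow> act \<xi> *v v \<noteq> 0"
proof
  assume "\<xi> \<in> V" "v \<noteq> 0" "act \<xi> *v v = 0"
  then have "wt v = wt 0" using wt_act[of \<xi> v] by simp
  also have "\<dots> = {}" by (simp add: wt_def)
  finally show False using wt_nonempty[OF \<open>v \<noteq> 0\<close>] by simp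
qed

lemma m_in_hull:
  assumes "v \<noteq> 0"
  shows "m (proj v) \<in> convex hull (wt v)"
proof -
  let ?I = "{e\<in>E. v \<bullet> e \<noteq> 0}"
  have "m (proj v) = (\<Sum>e\<in>?I. ((v \<bullet> e)\<^sup>2 / (v \<bullet> v)) *\<^sub>R vertex e)"
    unfolding m[OF assms] vertex_def using finite_E by (intro sum.mono_neutral_right) auto
  also have "\<dots> \<in> convex hull (wt v)"
  proof (rule convex_sum)
    have "(\<Sum>e\<in>?I. (v \<bullet> e)\<^sup>2) = v \<bullet> v"
      unfolding parseval[symmetric] using finite_E by (intro sum.mono_neutral_left) auto
    then show "(\<Sum>e\<in>?I. (v \<bullet> e)\<^sup>2 / (v \<bullet> v)) = 1"
      using assms by (simp flip: sum_divide_distrib)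
    show "vertex e \<in> convex hull (wt v)" if "e \<in> ?I" for e
      using that by (auto simp: wt_def intro!: hull_inc)
  qed (use finite_E in simp_all)
  finally show ?thesis .
qed

lemma continuous_m: "continuous_on UNIV m"
proof (rule continuous_on_cproj)
  have "continuous_on (- {0}) (\<lambda>v. \<Sum>e\<in>E. ((v \<bullet> e)\<^sup>2 / (v \<bullet> v)) *\<^sub>R (T (w e) + k))"
    by (intro continuous_intros) auto
  then show "continuous_on (- {0}) (\<lambda>v. m (proj v))"
    by (rule continuous_on_eq) (simp add: m)
qed

lemma orbit_proj: "v \<noteq> 0 \<Longrightarrow> orbit (act ` V) (proj v) = (\<lambda>\<xi>. proj (act \<xi> *v v)) ` V"
  by (simp add: orbit_def image_image pact_proj)

section \<open>Images of orbits and their closures\<close>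

text \<open>Moving along the orbit multiplies the masses \<open>(v \<bullet> e)\<^sup>2\<close> by
  exponentials of the weights, so the tuned exponential masses give the required point.\<close>

lemma interior_point_in_orbit_image:
  assumes v: "v \<noteq> 0" and I: "I = {e\<in>E. v \<bullet> e \<noteq> 0}"
    and t: "\<And>e. e \<in> I \<Longrightarrow> t e > 0" "sum t I = 1"
  shows "(\<Sum>e\<in>I. t e *\<^sub>R vertex e) \<in> m ` orbit (act ` V) (proj v)"
proof -
  have finI: "finite I" using finite_E I by simp
  have "I \<noteq> {}" using t(2) by auto
  \<comment> \<open>The barycentre is prescribed among the weights, where the exponentials live, and
    carried to the image by \<open>T\<close> afterwards.\<close>
  define q where "q = (\<Sum>e\<in>I. t e *\<^sub>R w e)"
  define p where "p = (\<Sum>e\<in>I. t e *\<^sub>R vertex e)"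
  have pq: "p = T q + k"
    using t(2) by (simp add: p_def q_def vertex_def linear_sum[OF T_linear] linear_scale[OF T_linear]
        scaleR_add_right sum.distrib flip: scaleR_sum_left)
  obtain x where x: "x \<in> span (w ` I)" "(\<Sum>e\<in>I. ((v \<bullet> e)\<^sup>2 * exp (w e \<bullet> x)) *\<^sub>R (w e - q)) = 0"
    using exp_sum_critical_point[OF finI \<open>I \<noteq> {}\<close> t, of "\<lambda>e. (v \<bullet> e)\<^sup>2" q w] I q_def by auto
  define a where "a e = (v \<bullet> e)\<^sup>2 * exp (w e \<bullet> x)" for e
  have "span (w ` I) \<subseteq> V" using w_in V I by (intro span_minimal) auto
  \<comment> \<open>Half of \<open>x\<close>, because the masses are squares of the
    coordinates.\<close>
  then have xV: "x /\<^sub>R 2 \<in> V" using x(1) V subspace_scale by blast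
  define u where "u = act (x /\<^sub>R 2) *v v"
  have u: "u \<noteq> 0" unfolding u_def using act_nonzero[OF xV v] .
  have ue: "(u \<bullet> e)\<^sup>2 = a e" if "e \<in> E" for e
    using inner_act[OF xV that, of v] by (simp add: u_def a_def power_mult_distrib flip: exp_double)
  have uu: "u \<bullet> u = sum a I"
    unfolding parseval[symmetric] using finite_E ue
    by (simp add: I) (rule sum.mono_neutral_right, auto simp: a_def)
  have "(\<Sum>e\<in>I. a e *\<^sub>R (vertex e - p)) = T (\<Sum>e\<in>I. a e *\<^sub>R (w e - q))"
    by (simp add: linear_sum[OF T_linear] linear_scale[OF T_linear] linear_diff[OF T_linear] vertex_def pq)
  also have "\<dots> = 0" using x(2) linear_0[OF T_linear] by (simp add: a_def)
  finally have "(\<Sum>e\<in>I. a e *\<^sub>R vertex e) = (u \<bullet> u) *\<^sub>R p"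
    by (simp add: uu scaleR_diff_right sum_subtractf scaleR_sum_left)
  moreover have "m (proj u) = (\<Sum>e\<in>I. a e *\<^sub>R vertex e) /\<^sub>R (u \<bullet> u)"
  proof -
    have "m (proj u) = (\<Sum>e\<in>E. (a e / (u \<bullet> u)) *\<^sub>R vertex e)"
      by (simp add: m[OF u] ue vertex_def)
    also have "\<dots> = (\<Sum>e\<in>I. (a e / (u \<bullet> u)) *\<^sub>R vertex e)"
      using finite_E by (intro sum.mono_neutral_right) (auto simp: I a_def)
    finally show ?thesis by (simp add: scaleR_sum_right divide_inverse_commute)
  qed
  ultimately have "m (proj u) = p" using u by simp
  moreover have "proj u \<in> orbit (act ` V) (proj v)" using xV v by (auto simp: orbit_proj u_def)
  ultimately show ?thesis unfolding p_def by (metis imageI)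
qed

lemma hull_subset_closure_orbit_image:
  assumes v: "v \<noteq> 0"
  shows "convex hull (wt v) \<subseteq> closure (m ` orbit (act ` V) (proj v))"
proof -
  define I where "I = {e\<in>E. v \<bullet> e \<noteq> 0}"
  have finI: "finite I" using finite_E I_def by simp
  have "I \<noteq> {}" using wt_nonempty[OF v] by (auto simp: wt_def I_def)
  then have cI: "real (card I) > 0" using finI by (simp add: card_gt_0_iff)
  \<comment> \<open>Coefficients are indexed by basis vectors, not by points of the hull, since
    several vectors may share a vertex.\<close>
  define Q where "Q = {\<Sum>e\<in>I. t e *\<^sub>R vertex e |t. (\<forall>e\<in>I. t e \<ge> 0) \<and> sum t I = (1::real)}"
  have "convex hull (wt v) \<subseteq> Q"
  proof (rule hull_minimal)
    show "wt v \<subseteq> Q"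
    proof
      fix p assume "p \<in> wt v"
      then obtain e where e: "e \<in> I" "p = vertex e" by (auto simp: wt_def I_def)
      then have "p = (\<Sum>e'\<in>I. (if e' = e then 1 else 0) *\<^sub>R vertex e')"
        using finI by (simp add: if_distrib[of "\<lambda>r. r *\<^sub>R _"] cong: if_cong)
      then show "p \<in> Q" unfolding Q_def using e finI
        by (intro CollectI exI[of _ "\<lambda>e'. if e' = e then 1 else 0"]) auto
    qed
    show "convex Q"
      unfolding convex_def
    proof (intro ballI allI impI)
      fix x y and a b :: real assume "x \<in> Q" "y \<in> Q" and ab: "0 \<le> a" "0 \<le> b" "a + b = 1"
      then obtain s t where s: "\<forall>e\<in>I. s e \<ge> 0" "sum s I = 1" "x = (\<Sum>e\<in>I. s e *\<^sub>R vertex e)"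
        and t: "\<forall>e\<in>I. t e \<ge> 0" "sum t I = 1" "y = (\<Sum>e\<in>I. t e *\<^sub>R vertex e)"
        unfolding Q_def by blast
      have "a *\<^sub>R x + b *\<^sub>R y = (\<Sum>e\<in>I. (a * s e + b * t e) *\<^sub>R vertex e)"
        by (simp add: s(3) t(3) scaleR_sum_right scaleR_add_left sum.distrib)
      moreover have "(\<Sum>e\<in>I. a * s e + b * t e) = 1"
        using s(2) t(2) ab by (simp add: sum.distrib flip: sum_distrib_left)
      moreover have "\<forall>e\<in>I. a * s e + b * t e \<ge> 0" using s(1) t(1) ab by auto
      ultimately show "a *\<^sub>R x + b *\<^sub>R y \<in> Q"
        unfolding Q_def by (intro CollectI exI[of _ "\<lambda>e. a * s e + b * t e"]) auto
    qed
  qed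
  also have "Q \<subseteq> closure (m ` orbit (act ` V) (proj v))"
  proof
    fix p assume "p \<in> Q"
    then obtain t where t: "\<forall>e\<in>I. t e \<ge> 0" "sum t I = 1" and p: "p = (\<Sum>e\<in>I. t e *\<^sub>R vertex e)"
      unfolding Q_def by blast
    define c where "c n = 1 / (real n + 2)" for n
    have c: "0 < c n" "c n < 1" for n by (auto simp: c_def)
    \<comment> \<open>Mixing with the uniform distribution makes all coefficients positive; letting
      the share \<open>c n\<close> tend to zero recovers \<open>t\<close>.\<close>
    define s where "s n e = (1 - c n) * t e + c n / card I" for n e
    have "(\<lambda>n. \<Sum>e\<in>I. s n e *\<^sub>R vertex e) \<longlonglongrightarrow> (\<Sum>e\<in>I. ((1 - 0) * t e + 0 / card I) *\<^sub>R vertex e)"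
    proof -
      have "c \<longlonglongrightarrow> 0" unfolding c_def by real_asymp
      then show ?thesis unfolding s_def by (intro tendsto_intros) (use cI in auto)
    qed
    moreover have "(\<Sum>e\<in>I. s n e *\<^sub>R vertex e) \<in> m ` orbit (act ` V) (proj v)" for n
    proof (rule interior_point_in_orbit_image[OF v I_def])
      show "s n e > 0" if "e \<in> I" for e
        using t(1) that c[of n] cI by (auto simp: s_def intro!: add_nonneg_pos)
      have "sum (s n) I = (1 - c n) * sum t I + real (card I) * (c n / card I)"
        by (simp add: s_def sum.distrib sum_distrib_left)
      then show "sum (s n) I = 1" using t(2) cI by simp
    qed
    ultimately show "p \<in> closure (m ` orbit (act ` V) (proj v))"
      unfolding p by (intro closure_sequential[THEN iffD2] exI conjI) auto
  qed
  finally show ?thesis .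
qed

lemma m_closure_orbit:
  assumes v: "v \<noteq> 0"
  shows "m ` closure (orbit (act ` V) (proj v)) = convex hull (wt v)"
proof
  let ?O = "orbit (act ` V) (proj v)"
  have "m ` ?O \<subseteq> convex hull (wt v)"
  proof -
    have "m (proj (act \<xi> *v v)) \<in> convex hull (wt v)" if "\<xi> \<in> V" for \<xi>
      using m_in_hull[OF act_nonzero[OF that v]] wt_act[OF that] by simp
    then show ?thesis by (auto simp: orbit_proj[OF v])
  qed
  moreover have "closed (convex hull (wt v))"
    by (intro compact_imp_closed compact_convex_hull finite_imp_compact finite_wt)
  ultimately show "m ` closure ?O \<subseteq> convex hull (wt v)"
    using continuous_m by (intro image_closure_subset) (auto intro: continuous_on_subset)
  have "compact (closure ?O)" using compact_Int_closed[OF compact_UNIV_cproj, of "closure ?O"] by simp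
  then have "closed (m ` closure ?O)"
    by (intro compact_imp_closed compact_continuous_image) (auto intro: continuous_on_subset[OF continuous_m])
  then have "closure (m ` ?O) \<subseteq> m ` closure ?O"
    using closure_subset by (intro closure_minimal) auto
  then show "convex hull (wt v) \<subseteq> m ` closure ?O"
    using hull_subset_closure_orbit_image[OF v] by blast
qed

text \<open>Flowing in the direction dual to \<open>a\<close> makes the coordinates with maximal
  \<open>a \<bullet> vertex e\<close> dominate. After rescaling they stay fixed and the others
  decay, so the limit keeps exactly the weights on the supporting hyperplane.\<close>

lemma orbit_limit:
  assumes v: "v \<noteq> 0" and le: "\<And>p. p \<in> wt v \<Longrightarrow> a \<bullet> p \<le> b" and eq: "\<exists>p\<in>wt v. a \<bullet> p = b"
  obtains u where "u \<noteq> 0" "proj u \<in> closure (orbit (act ` V) (proj v))"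
    "wt u = {p\<in>wt v. a \<bullet> p = b}"
proof -
  obtain \<xi> where xi: "\<xi> \<in> V" "\<And>x. x \<in> V \<Longrightarrow> a \<bullet> T x = \<xi> \<bullet> x"
    by (rule linear_functional_on_subspace_inner[OF V, of "\<lambda>x. a \<bullet> T x"])
       (auto simp: linear_add[OF T_linear] linear_scale[OF T_linear] inner_simps)
  define u where "u = (\<Sum>e\<in>E. (if a \<bullet> vertex e = b then v \<bullet> e else 0) *\<^sub>R e)"
  have ue: "u \<bullet> e = (if a \<bullet> vertex e = b then v \<bullet> e else 0)" if "e \<in> E" for e
    unfolding u_def using that by (rule inner_sum_E)
  have wtu: "wt u = {p\<in>wt v. a \<bullet> p = b}" by (auto simp: wt_def ue split: if_splits)
  then have "wt u \<noteq> {}" using eq by auto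
  then have u: "u \<noteq> 0" by (auto simp: wt_def)
  have xiV: "real n *\<^sub>R \<xi> \<in> V" for n using xi(1) V subspace_scale by blast
  \<comment> \<open>The rescaling does not change the point of projective space;
    \<open>a \<bullet> k\<close> accounts for the translation in \<open>vertex\<close>, so that the
    exponents become \<open>a \<bullet> vertex e - b\<close>.\<close>
  define f where "f n = exp (real n * (a \<bullet> k - b)) *\<^sub>R (act (real n *\<^sub>R \<xi>) *v v)" for n :: nat
  have f: "f n = (\<Sum>e\<in>E. (exp (real n * (a \<bullet> vertex e - b)) * (v \<bullet> e)) *\<^sub>R e)" for n
    unfolding f_def act_expansion[OF xiV] scaleR_sum_right
  proof (intro sum.cong refl)
    fix e assume "e \<in> E"
    then have "w e \<bullet> \<xi> = a \<bullet> T (w e)" using xi(2) w_in by (simp add: inner_commute)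
    then have "exp (real n * (a \<bullet> k - b)) * exp (w e \<bullet> (real n *\<^sub>R \<xi>)) = exp (real n * (a \<bullet> vertex e - b))"
      by (simp add: vertex_def inner_add_right algebra_simps flip: exp_add)
    then show "exp (real n * (a \<bullet> k - b)) *\<^sub>R (exp (w e \<bullet> (real n *\<^sub>R \<xi>)) * (v \<bullet> e)) *\<^sub>R e
        = (exp (real n * (a \<bullet> vertex e - b)) * (v \<bullet> e)) *\<^sub>R e"
      by (simp add: mult.assoc[symmetric])
  qed
  have "f \<longlonglongrightarrow> u"
    unfolding f u_def
  proof (intro tendsto_sum tendsto_scaleR tendsto_const)
    fix e assume e: "e \<in> E"
    show "(\<lambda>n. exp (real n * (a \<bullet> vertex e - b)) * (v \<bullet> e)) \<longlonglongrightarrow> (if a \<bullet> vertex e = b then v \<bullet> e else 0)"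
    proof (cases "a \<bullet> vertex e = b \<or> v \<bullet> e = 0")
      case False
      then have neg: "a \<bullet> vertex e - b < 0" using le[of "vertex e"] e by (auto simp: wt_def)
      have "(\<lambda>n. exp (real n * c)) \<longlonglongrightarrow> 0" if "c < 0" for c :: real using that by real_asymp
      from tendsto_mult_right[OF this[OF neg], of "v \<bullet> e"] show ?thesis using False by simp
    qed auto
  qed
  have "proj (f n) = proj (act (real n *\<^sub>R \<xi>) *v v)" for n
    unfolding f_def by (simp add: proj_scaleR)
  then have fO: "proj (f n) \<in> orbit (act ` V) (proj v)" for n
    using xiV v by (simp add: orbit_proj)
  have "(\<lambda>n. proj (f n)) \<longlonglongrightarrow> proj u"
  proof (rule continuous_on_tendsto_compose[OF continuous_on_proj \<open>f \<longlonglongrightarrow> u\<close>])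
    show "\<forall>\<^sub>F n in sequentially. f n \<in> - {0}"
      using act_nonzero[OF xiV v] by (simp add: f_def)
  qed (use u in auto)
  then have "proj u \<in> closure (orbit (act ` V) (proj v))"
  proof (rule Lim_in_closed_set[rotated 3])
    show "\<forall>\<^sub>F n in sequentially. proj (f n) \<in> closure (orbit (act ` V) (proj v))"
      using fO closure_subset by (intro always_eventually) blast
  qed auto
  then show thesis using that u wtu by blast
qed

text \<open>As \<open>T\<close> is injective on \<open>V\<close>, a single point in
  \<open>wt v\<close> means a single weight, and \<open>act\<close> multiplies \<open>v\<close> by a
  scalar.\<close>

lemma fixed_if_wt_singleton:
  assumes v: "v \<noteq> 0" and wt: "wt v = {p}" and g: "g \<in> act ` V"
  shows "pact g (proj v) = proj v"
proof -
  obtain \<xi> where xi: "\<xi> \<in> V" "g = act \<xi>" using g by auto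
  have "p \<in> wt v" using wt by simp
  then obtain e0 where e0: "e0 \<in> E" "vertex e0 = p" by (auto simp: wt_def)
  have "act \<xi> *v v = (\<Sum>e\<in>E. (exp (w e0 \<bullet> \<xi>) * (v \<bullet> e)) *\<^sub>R e)"
    unfolding act_expansion[OF xi(1)]
  proof (intro sum.cong refl)
    fix e assume e: "e \<in> E"
    show "(exp (w e \<bullet> \<xi>) * (v \<bullet> e)) *\<^sub>R e = (exp (w e0 \<bullet> \<xi>) * (v \<bullet> e)) *\<^sub>R e"
    proof (cases "v \<bullet> e = 0")
      case False
      then have "vertex e \<in> wt v" using e by (auto simp: wt_def)
      then have "w e = w e0" using wt e e0 vertex_eq_iff by auto
      then show ?thesis by simp
    qed simp
  qed
  also have "\<dots> = exp (w e0 \<bullet> \<xi>) *\<^sub>R v"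
    using expansion[of v] by (simp flip: scaleR_scaleR scaleR_sum_right)
  finally show ?thesis using v xi by (simp add: pact_proj proj_scaleR)
qed

section \<open>Generic points and the convexity theorem\<close>

text \<open>\<open>J\<close> collects the weights that occur somewhere on \<open>X\<close>. The
  locus where one of them occurs is open since weights persist, and dense by the identity theorem;
  finitely many such loci are intersected.\<close>

lemma generic_weights:
  assumes an: "analytic_submanifold_cproj X" and conn: "connected X"
  obtains J G where "openin (top_of_set X) G" "X \<subseteq> closure G"
    "\<And>v. v \<noteq> 0 \<Longrightarrow> proj v \<in> X \<Longrightarrow> wt v \<subseteq> J"
    "\<And>v. v \<noteq> 0 \<Longrightarrow> proj v \<in> G \<Longrightarrow> wt v = J"
proof -
  define D where "D p = {proj v |v. v \<noteq> 0 \<and> proj v \<in> X \<and> p \<in> wt v}" for p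
  have D: "proj v \<in> D p \<longleftrightarrow> p \<in> wt v" if "v \<noteq> 0" "proj v \<in> X" for v p
    using that wt_proj unfolding D_def by blast
  define J where "J = {p\<in>vertex ` E. D p \<noteq> {}}"
  have finJ: "finite J" using finite_E by (simp add: J_def)
  have dense: "openin (top_of_set X) (D p) \<and> X \<subseteq> closure (D p)" if p: "p \<in> J" for p
  proof
    define O' where "O' = {proj v |v. v \<noteq> 0 \<and> p \<in> wt v}"
    have "{v. v \<noteq> 0 \<and> proj v \<in> O'} = - {0} \<inter> {v. p \<in> wt v}"
      using wt_proj unfolding O'_def by blast
    also have "open \<dots>" by (intro open_Int open_wt) auto
    finally have "open O'" by (simp add: open_cproj_def)
    moreover have "D p = X \<inter> O'" by (auto simp: D_def O'_def)
    ultimately show "openin (top_of_set X) (D p)" by auto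
    show "X \<subseteq> closure (D p)"
    proof (rule ccontr)
      assume "\<not> X \<subseteq> closure (D p)"
      then obtain x where x: "x \<in> X \<inter> - closure (D p)" by blast
      \<comment> \<open>All basis vectors of the weight at once, which makes their common vanishing
        invariant under complex scaling.\<close>
      let ?B = "{e\<in>E. vertex e = p}"
      have B: "(\<forall>e\<in>?B. v \<bullet> e = 0) \<longleftrightarrow> p \<notin> wt v" for v by (auto simp: wt_def)
      obtain y where "y \<in> D p" using p by (auto simp: J_def)
      then obtain v where v: "v \<noteq> 0" "proj v \<in> X" "p \<in> wt v" by (auto simp: D_def)
      have "\<forall>e\<in>?B. v \<bullet> e = 0"
      proof (rule analytic_submanifold_cproj_identity[OF an conn])
        show "open (- closure (D p))" by (intro open_Compl closed_closure)
        show "X \<inter> - closure (D p) \<noteq> {}" using x by blast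
        show "\<forall>e\<in>?B. v \<bullet> e = 0" if "v \<noteq> 0" "proj v \<in> X \<inter> - closure (D p)" for v
          unfolding B using D[of v p] that closure_subset by blast
        show "\<forall>e\<in>?B. (c *s v) \<bullet> e = 0" if "c \<noteq> 0" "\<forall>e\<in>?B. v \<bullet> e = 0" for c v
          using that unfolding B by (simp add: wt_scale)
      qed (use v in auto)
      then show False using v(3) unfolding B by blast
    qed
  qed
  define G where "G = X \<inter> (\<Inter>p\<in>J. D p)"
  have G: "openin (top_of_set X) G" "X \<subseteq> closure G"
    using openin_dense_Int_finite[OF finJ dense] by (auto simp: G_def)
  have sub: "wt v \<subseteq> J" if "v \<noteq> 0" "proj v \<in> X" for v
  proof
    fix p assume p: "p \<in> wt v"
    then have "proj v \<in> D p" using D that by blast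
    moreover have "p \<in> vertex ` E" using p by (auto simp: wt_def)
    ultimately show "p \<in> J" by (auto simp: J_def)
  qed
  have "wt v = J" if "v \<noteq> 0" "proj v \<in> G" for v
    using sub[of v] that D by (auto simp: G_def)
  then show thesis using that G sub by blast
qed

theorem convexity:
  assumes comp: "compact X" and conn: "connected X" and an: "analytic_submanifold_cproj X"
    and inv: "\<forall>g\<in>act ` V. \<forall>x\<in>X. pact g x \<in> X"
  shows "polytope (m ` X) \<and>
           (\<forall>p. p extreme_point_of (m ` X) \<longrightarrow> p \<in> m ` fixed_points (act ` V) X) \<and>
         openin (top_of_set X) {x\<in>X. m ` closure (orbit (act ` V) x) = m ` X} \<and>
         X \<subseteq> closure {x\<in>X. m ` closure (orbit (act ` V) x) = m ` X} \<and>
         (\<forall>\<sigma>. \<sigma> face_of (m ` X) \<and> \<sigma> \<noteq> {} \<longrightarrow>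
           (\<exists>Y. (\<exists>x\<in>X. Y = orbit (act ` V) x) \<and> Y \<subseteq> X \<and> m ` closure Y = \<sigma>))"
proof (cases "X = {}")
  case True
  then show ?thesis by (simp add: extreme_point_of_def polytope_empty)
next
  case False
  obtain J G where G: "openin (top_of_set X) G" "X \<subseteq> closure G"
    and J: "\<And>v. v \<noteq> 0 \<Longrightarrow> proj v \<in> X \<Longrightarrow> wt v \<subseteq> J"
      "\<And>v. v \<noteq> 0 \<Longrightarrow> proj v \<in> G \<Longrightarrow> wt v = J"
    using generic_weights[OF an conn] by metis
  have GX: "G \<subseteq> X" using G(1) by (rule openin_imp_subset)
  have "G \<noteq> {}" using G(2) False by auto
  then obtain z where "z \<in> G" by blast
  then obtain v where v: "v \<noteq> 0" "proj v \<in> G" using proj_cases[of z] by metis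
  have wtv: "wt v = J" using J(2) v by blast
  have vX: "proj v \<in> X" using v(2) GX by blast
  have "closed X" using comp by (rule compact_imp_closed)
  have orbX: "orbit (act ` V) x \<subseteq> X" if "x \<in> X" for x using inv that by (auto simp: orbit_def)
  have clX: "closure (orbit (act ` V) x) \<subseteq> X" if "x \<in> X" for x
    using orbX[OF that] \<open>closed X\<close> by (rule closure_minimal)
  \<comment> \<open>One inclusion holds pointwise because \<open>J\<close> contains all occurring
    weights; the other already follows from the orbit closure of the generic point
    \<open>proj v\<close>.\<close>
  have mX: "m ` X = convex hull J"
  proof
    show "m ` X \<subseteq> convex hull J"
    proof clarify
      fix x assume x: "x \<in> X"
      obtain u where u: "u \<noteq> 0" "x = proj u" by (rule proj_cases)
      then show "m x \<in> convex hull J" using m_in_hull[of u] J(1)[of u] x hull_mono by blast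
    qed
    show "convex hull J \<subseteq> m ` X"
      using m_closure_orbit[OF v(1)] clX[OF vX] wtv by auto
  qed
  have finJ: "finite J" using finite_wt[of v] wtv by simp
  then have poly: "polytope (m ` X)" unfolding mX polytope_def by blast
  have face: "\<exists>u. u \<noteq> 0 \<and> proj u \<in> X \<and> wt u = J \<inter> \<sigma>" if s: "\<sigma> face_of (m ` X)" "\<sigma> \<noteq> {}" for \<sigma>
  proof -
    have "\<sigma> exposed_face_of (m ` X)"
      using s poly by (simp add: exposed_face_of_polyhedron polytope_imp_polyhedron)
    then obtain a b where ab: "m ` X \<subseteq> {x. a \<bullet> x \<le> b}" "\<sigma> = m ` X \<inter> {x. a \<bullet> x = b}"
      by (auto simp: exposed_face_of_def)
    have JX: "J \<subseteq> m ` X" unfolding mX by (rule hull_subset)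
    \<comment> \<open>A face of the hull of a finite set is the hull of a subset of it, so a
      nonempty face contains a weight and the supporting value \<open>b\<close> is attained on
      \<open>wt v\<close>.\<close>
    have "J \<inter> \<sigma> \<noteq> {}"
    proof -
      obtain S where S: "S \<subseteq> J" "\<sigma> = convex hull S"
        using face_of_convex_hull_subset[OF finite_imp_compact[OF finJ] s(1)[unfolded mX]] by metis
      then have "S \<noteq> {}" using s(2) by auto
      then show ?thesis using S hull_subset[of S convex] by auto
    qed
    then have ex: "\<exists>p\<in>wt v. a \<bullet> p = b" using ab(2) wtv by auto
    have le: "a \<bullet> p \<le> b" if "p \<in> wt v" for p using that wtv JX ab(1) by auto
    obtain u where u: "u \<noteq> 0" "proj u \<in> closure (orbit (act ` V) (proj v))"
        "wt u = {p\<in>wt v. a \<bullet> p = b}"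
      by (rule orbit_limit[OF v(1) le ex])
    then have "wt u = J \<inter> \<sigma>" using ab(2) JX wtv by auto
    then show ?thesis using u clX[OF vX] by blast
  qed
  have face_hull: "convex hull (J \<inter> \<sigma>) = \<sigma>" if s: "\<sigma> face_of (m ` X)" for \<sigma>
  proof
    show "convex hull (J \<inter> \<sigma>) \<subseteq> \<sigma>"
      using s face_of_imp_convex by (intro hull_minimal) auto
    obtain S where S: "S \<subseteq> J" "\<sigma> = convex hull S"
      using face_of_convex_hull_subset[OF finite_imp_compact[OF finJ] s[unfolded mX]] by metis
    then have "S \<subseteq> J \<inter> \<sigma>" using hull_subset[of S convex] by auto
    then show "\<sigma> \<subseteq> convex hull (J \<inter> \<sigma>)" using S(2) hull_mono by metis
  qed
  define R where "R = {x\<in>X. m ` closure (orbit (act ` V) x) = m ` X}"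
  have R: "proj u \<in> R \<longleftrightarrow> convex hull (wt u) = convex hull J" if "u \<noteq> 0" "proj u \<in> X" for u
    using that m_closure_orbit mX by (simp add: R_def)
  \<comment> \<open>\<open>R\<close> may be larger than \<open>G\<close>: a point may lack weights
    that are not vertices of the hull. Near \<open>u\<close> the weight set lies between
    \<open>wt u\<close> and \<open>J\<close>, which already have the same hull.\<close>
  have "openin (top_of_set X) R"
  proof (subst openin_subopen, intro ballI)
    fix x assume x: "x \<in> R"
    obtain u where u: "u \<noteq> 0" "x = proj u" by (rule proj_cases)
    define O' where "O' = {proj y |y. y \<noteq> 0 \<and> wt u \<subseteq> wt y}"
    have "{y. y \<noteq> 0 \<and> proj y \<in> O'} = {y. y \<noteq> 0 \<and> wt u \<subseteq> wt y}"
      using wt_proj unfolding O'_def by blast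
    also have "\<dots> = - {0} \<inter> (\<Inter>p\<in>wt u. {y. p \<in> wt y})" by auto
    also have "open \<dots>"
      by (intro open_Int open_INT finite_wt ballI open_wt) auto
    finally have "open O'" by (simp add: open_cproj_def)
    moreover have "x \<in> O'" using u by (auto simp: O'_def)
    moreover have "X \<inter> O' \<subseteq> R"
    proof
      fix y' assume y': "y' \<in> X \<inter> O'"
      then obtain y where y: "y' = proj y" "y \<noteq> 0" "wt u \<subseteq> wt y" by (auto simp: O'_def)
      have "convex hull (wt u) = convex hull J" using x u R by (auto simp: R_def)
      moreover have "wt y \<subseteq> J" using J(1) y y' by auto
      ultimately have "convex hull (wt y) = convex hull J"
        using hull_mono[of "wt y" J convex] hull_mono[OF y(3), of convex] by auto
      then show "y' \<in> R" using R y y' by auto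
    qed
    ultimately show "\<exists>T. openin (top_of_set X) T \<and> x \<in> T \<and> T \<subseteq> R"
      using x by (intro exI[of _ "X \<inter> O'"]) (auto simp: R_def)
  qed
  moreover have "G \<subseteq> R"
  proof
    fix x assume x: "x \<in> G"
    obtain u where u: "u \<noteq> 0" "x = proj u" by (rule proj_cases)
    then show "x \<in> R" using R[of u] J(2)[of u] x GX by auto
  qed
  then have "X \<subseteq> closure R" using G(2) closure_mono by blast
  moreover have "p \<in> m ` fixed_points (act ` V) X" if p: "p extreme_point_of (m ` X)" for p
  proof -
    \<comment> \<open>An extreme point is a one-point face; the limit point belonging to it carries
      a single weight and is therefore fixed.\<close>
    have "{p} face_of (m ` X)" using p by (simp add: face_of_singleton)
    then obtain u where u: "u \<noteq> 0" "proj u \<in> X" "wt u = J \<inter> {p}" using face by blast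
    then have wtu: "wt u = {p}" using wt_nonempty[OF u(1)] by auto
    then have "m (proj u) = p" using m_in_hull[OF u(1)] by simp
    moreover have "proj u \<in> fixed_points (act ` V) X"
      using u(2) fixed_if_wt_singleton[OF u(1) wtu] by (simp add: fixed_points_def)
    ultimately show ?thesis by blast
  qed
  moreover have "\<exists>Y. (\<exists>x\<in>X. Y = orbit (act ` V) x) \<and> Y \<subseteq> X \<and> m ` closure Y = \<sigma>"
    if s: "\<sigma> face_of (m ` X)" "\<sigma> \<noteq> {}" for \<sigma>
  proof -
    obtain u where u: "u \<noteq> 0" "proj u \<in> X" "wt u = J \<inter> \<sigma>" using face[OF s] by blast
    then have "m ` closure (orbit (act ` V) (proj u)) = \<sigma>"
      using m_closure_orbit face_hull[OF s(1)] by simp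
    then show ?thesis using u orbX by blast
  qed
  ultimately show ?thesis using poly unfolding R_def by blast
qed

end


section \<open>The gradient map\<close>

lemma inner_eq_Re_herm: "x \<bullet> y = Re (herm x y)"
  by (simp add: inner_vec_def herm_def inner_complex_def)

lemma herm_commute: "herm y x = cnj (herm x y)"
  by (simp add: herm_def mult.commute)

lemma herm_scalar_left: "herm (c *s x) y = c * herm x y"
  by (simp add: herm_def sum_distrib_left mult.assoc)

lemma herm_matrix_vector_mult: "herm (A *v x) y = herm x (cadj A *v y)"
proof -
  have "herm (A *v x) y = (\<Sum>i\<in>UNIV. \<Sum>j\<in>UNIV. A $ i $ j * x $ j * cnj (y $ i))"
    by (simp add: herm_def matrix_vector_mult_def sum_distrib_right)
  also have "\<dots> = (\<Sum>j\<in>UNIV. \<Sum>i\<in>UNIV. A $ i $ j * x $ j * cnj (y $ i))"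
    by (rule sum.swap)
  also have "\<dots> = herm x (cadj A *v y)"
    by (simp add: herm_def matrix_vector_mult_def cadj_def sum_distrib_left mult_ac)
  finally show ?thesis .
qed

lemma hermitian_inner: "cadj A = A \<Longrightarrow> (A *v x) \<bullet> y = x \<bullet> (A *v y)"
  by (simp add: inner_eq_Re_herm herm_matrix_vector_mult)

lemma scaleR_matrix_vector_mult_complex: "(r *\<^sub>R A) *v x = r *\<^sub>R (A *v (x :: complex^'n))"
  by (simp add: vec_eq_iff matrix_vector_mult_def scaleR_sum_right)

lemma imul_matrix_vector_mult: "imul A *v x = \<i> *s (A *v x)"
  by (simp add: vec_eq_iff imul_def matrix_vector_mult_def sum_distrib_left mult.assoc)

lemma linear_imul: "linear imul"
  by (intro linearI) (simp_all add: imul_def vec_eq_iff algebra_simps)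

lemma imul_eq_0_iff: "imul A = 0 \<longleftrightarrow> A = 0"
  by (simp add: imul_def vec_eq_iff)

lemma isu_hermitian:
  assumes "A \<in> imul ` su"
  shows "cadj A = A" "imul A \<in> su"
proof -
  obtain S where S: "A = imul S" "cadj S = - S" "trace S = 0"
    using assms by (auto simp: su_def)
  have "cnj (S $ j $ i) = - S $ i $ j" for i j
    using arg_cong[OF S(2), of "\<lambda>m. m $ i $ j"] by (simp add: cadj_def)
  then show "cadj A = A" by (simp add: S(1) cadj_def imul_def vec_eq_iff)
  have "imul A = - S" by (simp add: S(1) imul_def vec_eq_iff)
  moreover have "cadj (- S) = - cadj S" by (simp add: cadj_def vec_eq_iff)
  moreover have "trace (- S) = - trace S" by (simp add: trace_def sum_negf)
  ultimately show "imul A \<in> su" using S(2,3) by (simp add: su_def)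
qed

text \<open>The right-hand side is \<open>- \<kappa> / 2\<close> times the derivative in direction
  \<open>u\<close> of the Rayleigh quotient \<open>((A *v v) \<bullet> v) / (v \<bullet> v)\<close>,
  which identifies the components of the momentum map.\<close>

lemma fubini_study_hermitian:
  assumes "cadj A = A"
  shows "fubini_study \<kappa> v (imul A *v v) u =
    - \<kappa> * (((A *v v) \<bullet> u) / (v \<bullet> v) - ((A *v v) \<bullet> v) * (v \<bullet> u) / (v \<bullet> v)\<^sup>2)"
proof -
  have "cnj (herm (A *v v) v) = herm (A *v v) v"
    using herm_matrix_vector_mult[of A v v] herm_commute[of v "A *v v"] assms by simp
  then have real: "herm (A *v v) v = complex_of_real ((A *v v) \<bullet> v)"
    by (simp add: inner_eq_Re_herm complex_eq_iff)
  have n2: "(norm v)\<^sup>2 = v \<bullet> v" by (simp add: power2_norm_eq_inner)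
  then have n4: "norm v ^ 4 = (v \<bullet> v)\<^sup>2" by (metis power_even_eq numeral_Bit0 mult_2)
  have "fubini_study \<kappa> v (imul A *v v) u = - \<kappa> * Im (\<i> * herm (A *v v) u / complex_of_real (v \<bullet> v)
      - \<i> * complex_of_real ((A *v v) \<bullet> v) * herm v u / complex_of_real ((v \<bullet> v)\<^sup>2))"
    unfolding fubini_study_def imul_matrix_vector_mult herm_scalar_left real n2[symmetric] n4[symmetric]
    by (simp add: mult.assoc)
  then show ?thesis by (simp add: inner_eq_Re_herm Im_divide_of_real del: of_real_power)
qed

text \<open>The component of \<open>\<mu>\<close> along \<open>imul A\<close> and
  \<open>\<kappa> / 2\<close> times the Rayleigh quotient have opposite derivatives. Their sum is
  constant, since the punctured space has real dimension at least 2 and is connected.\<close>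

lemma momentum_map_hermitian:
  fixes \<mu> :: "('n::finite) cproj \<Rightarrow> complex^'n^'n"
  assumes mm: "momentum_map \<kappa> ip \<mu>" and A: "A \<in> imul ` su" and vu: "v \<noteq> 0" "u \<noteq> 0"
  shows "ip (\<mu> (proj v)) (imul A) + \<kappa> / 2 * (((A *v v) \<bullet> v) / (v \<bullet> v)) =
    ip (\<mu> (proj u)) (imul A) + \<kappa> / 2 * (((A *v u) \<bullet> u) / (u \<bullet> u))"
proof -
  define f where "f v = ip (\<mu> (proj v)) (imul A) + \<kappa> / 2 * (((A *v v) \<bullet> v) / (v \<bullet> v))" for v
  note herm = isu_hermitian[OF A]
  have "(f has_derivative (\<lambda>x. 0)) (at x)" if "x \<in> - {0}" for x
  proof -
    have x: "x \<bullet> x \<noteq> 0" using that by simp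
    have 1: "((\<lambda>v. ip (\<mu> (proj v)) (imul A)) has_derivative (\<lambda>w. fubini_study \<kappa> x (imul A *v x) w)) (at x)"
      using mm herm(2) that unfolding momentum_map_def by blast
    have bl: "bounded_linear ((*v) A)" by (simp add: linear_conv_bounded_linear[symmetric])
    have 2: "((\<lambda>v. (A *v v) \<bullet> v) has_derivative (\<lambda>w. (A *v x) \<bullet> w + (A *v w) \<bullet> x)) (at x)"
      by (intro has_derivative_inner bounded_linear_imp_has_derivative bl has_derivative_ident)
    have 3: "((\<lambda>v. v \<bullet> v) has_derivative (\<lambda>w. x \<bullet> w + w \<bullet> x)) (at x)"
      by (intro has_derivative_inner has_derivative_ident)
    have "(f has_derivative (\<lambda>w. fubini_study \<kappa> x (imul A *v x) w + \<kappa> / 2 *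
       ((((A *v x) \<bullet> w + (A *v w) \<bullet> x) * (x \<bullet> x) - (A *v x) \<bullet> x * (x \<bullet> w + w \<bullet> x)) / ((x \<bullet> x) * (x \<bullet> x))))) (at x)"
      unfolding f_def
      by (intro has_derivative_add has_derivative_mult_right has_derivative_divide' 1 2 3 x)
    moreover have "fubini_study \<kappa> x (imul A *v x) w + \<kappa> / 2 *
       ((((A *v x) \<bullet> w + (A *v w) \<bullet> x) * (x \<bullet> x) - (A *v x) \<bullet> x * (x \<bullet> w + w \<bullet> x)) / ((x \<bullet> x) * (x \<bullet> x))) = 0" for w
    proof -
      have sym: "(A *v w) \<bullet> x = (A *v x) \<bullet> w" "w \<bullet> x = x \<bullet> w"
        using hermitian_inner[OF herm(1)] by (simp_all add: inner_commute)
      show ?thesis unfolding fubini_study_hermitian[OF herm(1)] sym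
        using x by (simp add: field_simps power2_eq_square)
    qed
    ultimately show ?thesis by simp
  qed
  moreover have "connected (- {0 :: complex^'n})"
    by (rule connected_punctured_universe) (simp add: Suc_leI)
  ultimately have "f v = f u"
    using vu by (intro has_derivative_zero_unique_connected[of "- {0}" f]) auto
  then show ?thesis by (simp add: f_def)
qed

text \<open>Convergence of the matrix series has to be established before it can be applied to
  \<open>e\<close>. The full eigenbasis is used for this: it writes each entry of a power of
  \<open>A\<close> as a combination of powers of eigenvalues.\<close>

lemma mat_exp_eigenvector:
  fixes A :: "complex^'n^'n"
  assumes E: "pairwise orthogonal E" "\<And>e. e \<in> E \<Longrightarrow> norm e = 1" "span E = UNIV"
    and eig: "\<And>e. e \<in> E \<Longrightarrow> A *v e = l e *\<^sub>R e" and e: "e \<in> E"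
  shows "mat_exp A *v e = exp (l e) *\<^sub>R e"
proof -
  define P where "P k = ((**) A ^^ k) (mat 1)" for k
  have Pe: "P k *v e = l e ^ k *\<^sub>R e" if "e \<in> E" for k e
  proof (induction k)
    case (Suc k)
    have lin: "linear ((*v) A)" by simp
    have "P (Suc k) *v e = A *v (P k *v e)" by (simp add: P_def matrix_vector_mul_assoc)
    then show ?case using Suc eig[OF that] by (simp add: linear_scale[OF lin] mult.commute)
  qed (simp add: P_def)
  have Pv: "P k *v v = (\<Sum>e\<in>E. ((v \<bullet> e) * l e ^ k) *\<^sub>R e)" for k v
  proof -
    have lin: "linear ((*v) (P k))" by simp
    have "P k *v v = P k *v (\<Sum>e\<in>E. (v \<bullet> e) *\<^sub>R e)" using orthonormal_expansion[OF E(1,2)] E(3) by simp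
    then show ?thesis by (simp add: linear_sum[OF lin] linear_scale[OF lin] Pe)
  qed
  have Pij: "P k $ i $ j = (\<Sum>e\<in>E. l e ^ k *\<^sub>R ((axis j 1 \<bullet> e) *\<^sub>R e $ i))" for k i j
  proof -
    have "P k $ i $ j = (P k *v axis j 1) $ i"
      by (simp add: matrix_vector_mult_def axis_def if_distrib[of "(*) _"] cong: if_cong)
    then show ?thesis by (simp add: Pv sum_component mult.commute)
  qed
  define S where "S = (\<chi> i j. \<Sum>e\<in>E. exp (l e) *\<^sub>R ((axis j 1 \<bullet> e) *\<^sub>R e $ i))"
  have ij: "(\<lambda>k. ((1 / fact k) *\<^sub>R P k) $ i $ j) sums (S $ i $ j)" for i j
  proof -
    have "(\<lambda>k. \<Sum>e\<in>E. (l e ^ k /\<^sub>R fact k) *\<^sub>R ((axis j 1 \<bullet> e) *\<^sub>R e $ i)) sums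
        (\<Sum>e\<in>E. exp (l e) *\<^sub>R ((axis j 1 \<bullet> e) *\<^sub>R e $ i))"
      by (intro sums_sum bounded_linear.sums[OF bounded_linear_scaleR_left] exp_converges)
    then show ?thesis by (simp add: S_def Pij scaleR_sum_right divide_inverse mult.assoc)
  qed
  have S: "(\<lambda>k. (1 / fact k) *\<^sub>R P k) sums S"
    unfolding sums_def
  proof (intro vec_tendstoI)
    show "((\<lambda>n. (\<Sum>k<n. (1 / fact k) *\<^sub>R P k) $ i $ j) \<longlongrightarrow> S $ i $ j) sequentially" for i j
      using ij[of i j] by (simp add: sums_def sum_component)
  qed
  have "mat_exp A = S"
    using sums_unique[OF S] by (simp add: mat_exp_def P_def)
  have "linear (\<lambda>M :: complex^'n^'n. M *v e)"
    by (intro linearI) (simp_all add: matrix_vector_mult_add_rdistrib scaleR_matrix_vector_mult_complex)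
  from bounded_linear.sums[OF this[unfolded linear_conv_bounded_linear] S]
  have "(\<lambda>k. (l e ^ k /\<^sub>R fact k) *\<^sub>R e) sums (mat_exp A *v e)"
    unfolding \<open>mat_exp A = S\<close> by (simp add: Pe[OF e] divide_inverse scaleR_matrix_vector_mult_complex)
  moreover have "(\<lambda>k. (l e ^ k /\<^sub>R fact k) *\<^sub>R e) sums (exp (l e) *\<^sub>R e)"
    by (intro bounded_linear.sums[OF bounded_linear_scaleR_left] exp_converges)
  ultimately show ?thesis by (rule sums_unique2)
qed

section \<open>The gradient map in weight coordinates\<close>

lemma gradient_map_weight_basis:
  fixes \<mu> :: "('n::finite) cproj \<Rightarrow> complex^'n^'n"
  assumes isp: "invariant_scalar_product ip" and \<kappa>: "\<kappa> > 0" and mm: "momentum_map \<kappa> ip \<mu>"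
    and ab: "abelian_subalgebra_isu \<aa>"
  obtains E w T k where "weight_basis E w \<aa> mat_exp T k (gradient_map ip \<mu> \<aa>)"
proof -
  have V: "subspace \<aa>" and isu: "\<And>\<beta>. \<beta> \<in> \<aa> \<Longrightarrow> \<beta> \<in> imul ` su"
    and comm: "\<And>\<beta> \<gamma>. \<beta> \<in> \<aa> \<Longrightarrow> \<gamma> \<in> \<aa> \<Longrightarrow> \<beta> ** \<gamma> = \<gamma> ** \<beta>"
    using ab by (auto simp: abelian_subalgebra_isu_def)
  note adj = hermitian_inner[OF isu_hermitian(1)[OF isu]]
  note su = isu_hermitian(2)[OF isu]
  have ip_add: "ip (x + y) z = ip x z + ip y z" and ip_scale: "ip (r *\<^sub>R x) z = r * ip x z"
    and ip_sym: "ip x z = ip z x" and ip_pos: "x \<noteq> 0 \<Longrightarrow> ip x x > 0"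
    if "x \<in> su" "y \<in> su" "z \<in> su" for x y z r
    using isp that unfolding invariant_scalar_product_def by blast+
  have "\<exists>B\<subseteq>UNIV. pairwise orthogonal B \<and> (\<forall>b\<in>B. norm b = 1) \<and> span B = UNIV \<and>
      (\<forall>b\<in>B. \<forall>f\<in>(\<lambda>\<beta>. (*v) \<beta>) ` \<aa>. \<exists>l. f b = l *\<^sub>R b)"
    by (rule commuting_self_adjoint_eigenbasis)
       (auto simp: adj matrix_vector_mul_assoc comm)
  then obtain E where E: "pairwise orthogonal E" "\<And>e. e \<in> E \<Longrightarrow> norm e = 1" "span E = UNIV"
    and eig: "\<And>e \<beta>. e \<in> E \<Longrightarrow> \<beta> \<in> \<aa> \<Longrightarrow> \<exists>l. \<beta> *v e = l *\<^sub>R e"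
    by (auto simp: image_iff)
  \<comment> \<open>On a unit eigenvector \<open>(\<beta> *v e) \<bullet> e\<close> is the
    eigenvalue; in this form it is visibly linear in \<open>\<beta>\<close>.\<close>
  have "\<exists>x. x \<in> \<aa> \<and> (\<forall>\<beta>\<in>\<aa>. (\<beta> *v e) \<bullet> e = x \<bullet> \<beta>)" for e
    by (rule linear_functional_on_subspace_inner[OF V, of "\<lambda>\<beta>. (\<beta> *v e) \<bullet> e"])
       (auto simp: matrix_vector_mult_add_rdistrib inner_add_left simp: scaleR_matrix_vector_mult_complex)
  then obtain w where w: "\<And>e. w e \<in> \<aa>" "\<And>e \<beta>. \<beta> \<in> \<aa> \<Longrightarrow> (\<beta> *v e) \<bullet> e = w e \<bullet> \<beta>" by metis
  have eigw: "\<beta> *v e = (w e \<bullet> \<beta>) *\<^sub>R e" if e: "e \<in> E" and b: "\<beta> \<in> \<aa>" for e \<beta>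
  proof -
    obtain l where l: "\<beta> *v e = l *\<^sub>R e" using eig e b by blast
    have "w e \<bullet> \<beta> = l" using w(2)[OF b, of e] E(2)[OF e] by (simp add: l norm_eq_1)
    then show ?thesis using l by simp
  qed
  have expn: "(\<Sum>e\<in>E. (v \<bullet> e) *\<^sub>R e) = v" for v
    using orthonormal_expansion[OF E(1,2)] E(3) by simp
  have quad: "(\<beta> *v v) \<bullet> v = (\<Sum>e\<in>E. (v \<bullet> e)\<^sup>2 * (w e \<bullet> \<beta>))" if "\<beta> \<in> \<aa>" for \<beta> v
  proof -
    have lin: "linear ((*v) \<beta>)" by simp
    have "\<beta> *v v = (\<Sum>e\<in>E. (v \<bullet> e) *\<^sub>R (\<beta> *v e))"
      by (subst (1) expn[of v, symmetric]) (simp only: linear_sum[OF lin] linear_scale[OF lin])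
    also have "\<dots> = (\<Sum>e\<in>E. ((v \<bullet> e) * (w e \<bullet> \<beta>)) *\<^sub>R e)"
      by (intro sum.cong) (simp_all add: eigw[OF _ that])
    finally have eq: "\<beta> *v v = (\<Sum>e\<in>E. ((v \<bullet> e) * (w e \<bullet> \<beta>)) *\<^sub>R e)" .
    show ?thesis
      unfolding eq inner_sum_left power2_eq_square
      by (intro sum.cong refl) (simp add: inner_commute mult_ac)
  qed
  have parseval: "(\<Sum>e\<in>E. (v \<bullet> e)\<^sup>2) = v \<bullet> v" for v
  proof -
    have "(\<Sum>e\<in>E. (v \<bullet> e)\<^sup>2) = v \<bullet> (\<Sum>e\<in>E. (v \<bullet> e) *\<^sub>R e)"
      by (simp add: inner_sum_right power2_eq_square)
    then show ?thesis by (simp only: expn)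
  qed
  \<comment> \<open>An arbitrary reference point, at which the integration constant of
    \<open>\<mu>\<close> is read off and then represented by \<open>k0\<close>.\<close>
  define v0 :: "complex^'n" where "v0 = (\<chi> i. 1)"
  have v0: "v0 \<noteq> 0" by (simp add: v0_def vec_eq_iff)
  note li = linear_add[OF linear_imul] linear_scale[OF linear_imul]
  have musu: "\<mu> z \<in> su" for z using mm by (simp add: momentum_map_def)
  have ipr: "ip (\<mu> z) (imul (\<beta> + \<gamma>)) = ip (\<mu> z) (imul \<beta>) + ip (\<mu> z) (imul \<gamma>)"
       "ip (\<mu> z) (imul (r *\<^sub>R \<beta>)) = r * ip (\<mu> z) (imul \<beta>)"
     if "\<beta> \<in> \<aa>" "\<gamma> \<in> \<aa>" for z \<beta> \<gamma> r
  proof -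
    have s: "imul \<beta> \<in> su" "imul \<gamma> \<in> su" "imul (\<beta> + \<gamma>) \<in> su" "imul (r *\<^sub>R \<beta>) \<in> su"
      using that V by (auto intro!: su subspace_add subspace_scale)
    show "ip (\<mu> z) (imul (\<beta> + \<gamma>)) = ip (\<mu> z) (imul \<beta>) + ip (\<mu> z) (imul \<gamma>)"
      using ip_sym[OF musu musu, of _ z] s ip_add[OF s(1,2) musu[of z]] by (simp add: li)
    show "ip (\<mu> z) (imul (r *\<^sub>R \<beta>)) = r * ip (\<mu> z) (imul \<beta>)"
      using ip_sym[OF musu musu, of _ z] s ip_scale[OF s(1,2) musu[of z]] by (simp add: li)
  qed
  obtain k0 where k0: "k0 \<in> \<aa>" and k0_eq: "\<And>\<beta>. \<beta> \<in> \<aa> \<Longrightarrow>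
      - (ip (\<mu> (proj v0)) (imul \<beta>) + \<kappa> / 2 * (((\<beta> *v v0) \<bullet> v0) / (v0 \<bullet> v0))) = k0 \<bullet> \<beta>"
    by (rule linear_functional_on_subspace_inner[OF V, of
        "\<lambda>\<beta>. - (ip (\<mu> (proj v0)) (imul \<beta>) + \<kappa> / 2 * (((\<beta> *v v0) \<bullet> v0) / (v0 \<bullet> v0)))"])
       (auto simp: ipr matrix_vector_mult_add_rdistrib inner_add_left algebra_simps add_divide_distrib
         simp: scaleR_matrix_vector_mult_complex)
  obtain T where T: "linear T" "inj_on T \<aa>" "\<And>y. T y \<in> \<aa>" "\<And>y x. x \<in> \<aa> \<Longrightarrow> ip_isu ip (T y) x = y \<bullet> x"
  proof (rule scalar_product_representation[OF V, of "ip_isu ip"])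
    fix x y z r assume x: "x \<in> \<aa>"
    show "ip_isu ip x x > 0" if "x \<noteq> 0"
      using ip_pos[OF su[OF x] su[OF x] su[OF x]] that by (simp add: ip_isu_def imul_eq_0_iff)
    assume y: "y \<in> \<aa>"
    show "ip_isu ip (r *\<^sub>R x) y = r * ip_isu ip x y" "ip_isu ip x y = ip_isu ip y x"
      using ip_scale[OF su[OF x] su[OF x] su[OF y]] ip_sym[OF su[OF x] su[OF x] su[OF y]]
      by (simp_all add: ip_isu_def li)
    assume z: "z \<in> \<aa>"
    show "ip_isu ip (x + y) z = ip_isu ip x z + ip_isu ip y z"
      using ip_add[OF su[OF x] su[OF y] su[OF z]] by (simp add: ip_isu_def li)
  qed blast
  have grad: "gradient_map ip \<mu> \<aa> (proj v) =
      (\<Sum>e\<in>E. ((v \<bullet> e)\<^sup>2 / (v \<bullet> v)) *\<^sub>R (T ((\<kappa> / 2) *\<^sub>R w e) + T k0))" if v: "v \<noteq> 0" for v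
  proof -
    \<comment> \<open>The Euclidean representative of the functional that defines the gradient map;
      \<open>T\<close> turns it into the representative for \<open>ip_isu ip\<close>. The masses sum
      to 1, so \<open>k0\<close> enters as a plain translation.\<close>
    define y where "y = (\<Sum>e\<in>E. ((v \<bullet> e)\<^sup>2 / (v \<bullet> v)) *\<^sub>R ((\<kappa> / 2) *\<^sub>R w e + k0))"
    have y: "y \<bullet> \<beta> = - ip (\<mu> (proj v)) (imul \<beta>)" if b: "\<beta> \<in> \<aa>" for \<beta>
    proof -
      have "y \<bullet> \<beta> = (\<Sum>e\<in>E. ((v \<bullet> e)\<^sup>2 / (v \<bullet> v)) * (\<kappa> / 2 * (w e \<bullet> \<beta>) + k0 \<bullet> \<beta>))"
        by (simp add: y_def inner_sum_left inner_add_left)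
      also have "\<dots> = \<kappa> / 2 * ((\<Sum>e\<in>E. (v \<bullet> e)\<^sup>2 * (w e \<bullet> \<beta>)) / (v \<bullet> v))
          + (\<Sum>e\<in>E. (v \<bullet> e)\<^sup>2) / (v \<bullet> v) * (k0 \<bullet> \<beta>)"
        by (simp add: distrib_left sum.distrib sum_distrib_left sum_distrib_right sum_divide_distrib mult_ac)
      also have "\<dots> = \<kappa> / 2 * (((\<beta> *v v) \<bullet> v) / (v \<bullet> v)) + k0 \<bullet> \<beta>"
        using v by (simp add: quad[OF b] parseval)
      also have "\<dots> = - ip (\<mu> (proj v)) (imul \<beta>)"
        using momentum_map_hermitian[OF mm isu[OF b] v v0] k0_eq[OF b] by linarith
      finally show ?thesis .
    qed
    have "gradient_map ip \<mu> \<aa> (proj v) = T y"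
      unfolding gradient_map_def
    proof (rule the_equality)
      show "T y \<in> \<aa> \<and> (\<forall>\<beta>\<in>\<aa>. ip_isu ip (T y) \<beta> = - ip (\<mu> (proj v)) (imul \<beta>))"
        using T y by simp
    next
      fix \<xi> assume xi: "\<xi> \<in> \<aa> \<and> (\<forall>\<beta>\<in>\<aa>. ip_isu ip \<xi> \<beta> = - ip (\<mu> (proj v)) (imul \<beta>))"
      \<comment> \<open>Uniqueness: the difference of two representatives, tested against itself,
        vanishes by positive definiteness.\<close>
      define d where "d = \<xi> - T y"
      have d: "d \<in> \<aa>" unfolding d_def using xi T(3) V subspace_diff by blast
      have "ip_isu ip (d + T y) d = ip_isu ip d d + ip_isu ip (T y) d"
        using ip_add[OF su[OF d] su[OF T(3)] su[OF d]] by (simp add: ip_isu_def li)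
      moreover have "ip_isu ip (d + T y) d = ip_isu ip (T y) d"
        using xi d T(4)[OF d] y[OF d] by (simp add: d_def)
      ultimately have "ip_isu ip d d = 0" by simp
      then have "d = 0"
        using ip_pos[OF su[OF d] su[OF d] su[OF d]] by (auto simp: ip_isu_def imul_eq_0_iff)
      then show "\<xi> = T y" by (simp add: d_def)
    qed
    also have "\<dots> = (\<Sum>e\<in>E. ((v \<bullet> e)\<^sup>2 / (v \<bullet> v)) *\<^sub>R (T ((\<kappa> / 2) *\<^sub>R w e) + T k0))"
      unfolding y_def by (simp only: linear_sum[OF T(1)] linear_scale[OF T(1)] linear_add[OF T(1)])
    finally show ?thesis .
  qed
  \<comment> \<open>The factor \<open>\<kappa> / 2\<close> is absorbed into the linear map and not
    into the weights, which have to remain the exponents of \<open>mat_exp\<close>.\<close>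
  have "weight_basis E w \<aa> mat_exp (\<lambda>x. T ((\<kappa> / 2) *\<^sub>R x)) (T k0) (gradient_map ip \<mu> \<aa>)"
  proof (rule weight_basis.intro)
    show "mat_exp \<xi> *v e = exp (w e \<bullet> \<xi>) *\<^sub>R e" if "\<xi> \<in> \<aa>" "e \<in> E" for \<xi> e
      using mat_exp_eigenvector[OF E, of \<xi> "\<lambda>e. w e \<bullet> \<xi>"] eigw that by blast
    show "(c *s e) \<bullet> e' = 0" if e: "e \<in> E" "e' \<in> E" "w e \<noteq> w e'" for c e e'
    proof -
      \<comment> \<open>This element separates the two weights: its eigenvalues on \<open>e\<close>
        and \<open>e'\<close> differ by its squared norm. Since \<open>c *s e\<close> has the same
        eigenvalue as \<open>e\<close>, self-adjointness gives orthogonality.\<close>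
      define \<beta> where "\<beta> = w e - w e'"
      have b: "\<beta> \<in> \<aa>" unfolding \<beta>_def using w(1) V subspace_diff by blast
      have "\<beta> *v (c *s e) = (w e \<bullet> \<beta>) *\<^sub>R (c *s e)"
        using eigw[OF e(1) b]
        by (simp add: scaleR_eq_scalar_mult_complex vector_scalar_commute mult.commute)
      then have "(w e \<bullet> \<beta>) * ((c *s e) \<bullet> e') = (w e' \<bullet> \<beta>) * ((c *s e) \<bullet> e')"
        using adj[OF b, of "c *s e" e'] eigw[OF e(2) b] by simp
      moreover have "w e \<bullet> \<beta> - w e' \<bullet> \<beta> \<noteq> 0"
        using e(3) by (simp add: \<beta>_def flip: inner_diff_left)
      ultimately show ?thesis by auto
    qed
    show "linear (\<lambda>x. T ((\<kappa> / 2) *\<^sub>R x))"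
      by (intro linearI) (simp_all add: scaleR_add_right linear_add[OF T(1)] linear_scale[OF T(1)])
    show "inj_on (\<lambda>x. T ((\<kappa> / 2) *\<^sub>R x)) \<aa>"
      using \<kappa> inj_on_eq_iff[OF T(2)] V by (auto simp: inj_on_def subspace_scale)
  qed (use E V w grad in auto)
  then show thesis using that by blast
qed

theorem theorem1p1:
  fixes X :: "('n::finite) cproj set"
    and \<aa> A :: "(complex^'n^'n) set"
    and ip :: "complex^'n^'n \<Rightarrow> complex^'n^'n \<Rightarrow> real"
    and \<mu> \<mu>\<^sub>\<aa> :: "'n cproj \<Rightarrow> complex^'n^'n"
    and \<kappa> :: real
  assumes "invariant_scalar_product ip"
    and "\<kappa> > 0"
    and "momentum_map \<kappa> ip \<mu>"
    and "abelian_subalgebra_isu \<aa>"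
  defines "A \<equiv> mat_exp ` \<aa>"
    and "\<mu>\<^sub>\<aa> \<equiv> gradient_map ip \<mu> \<aa>"
  assumes "compact X" and "connected X" and "analytic_submanifold_cproj X"
    and "\<forall>g\<in>A. \<forall>x\<in>X. pact g x \<in> X"
  shows "polytope (\<mu>\<^sub>\<aa> ` X) \<and>
           (\<forall>p. p extreme_point_of (\<mu>\<^sub>\<aa> ` X) \<longrightarrow> p \<in> \<mu>\<^sub>\<aa> ` fixed_points A X) \<and>
         openin (top_of_set X) {x\<in>X. \<mu>\<^sub>\<aa> ` closure (orbit A x) = \<mu>\<^sub>\<aa> ` X} \<and>
         X \<subseteq> closure {x\<in>X. \<mu>\<^sub>\<aa> ` closure (orbit A x) = \<mu>\<^sub>\<aa> ` X} \<and>
         (\<forall>\<sigma>. \<sigma> face_of (\<mu>\<^sub>\<aa> ` X) \<and> \<sigma> \<noteq> {} \<longrightarrow>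
           (\<exists>Y. (\<exists>x\<in>X. Y = orbit A x) \<and> Y \<subseteq> X \<and> \<mu>\<^sub>\<aa> ` closure Y = \<sigma>))"
proof -
  obtain E w T k where "weight_basis E w \<aa> mat_exp T k \<mu>\<^sub>\<aa>"
    using gradient_map_weight_basis[OF assms(1-4)] unfolding \<mu>\<^sub>\<aa>_def by metis
  then show ?thesis
    using assms(7-10) unfolding A_def by (rule weight_basis.convexity)
qed

end
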